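(* Let $\Gamma$ be a group with identity element $e$ and let $R$ be a $\Gamma$-graded ring. If $R$ is strongly graded, then $K_0^{\mathrm{gr}}(R)\cong K_0(R_e)$ as abelian groups.
   Context: $\Gamma$ is an arbitrary multiplicative group. A $\Gamma$-graded ring is $R=\bigoplus_{\gamma\in\Gamma}R_\gamma$ with additive subgroups satisfying $R_\gamma R_\delta\subseteq R_{\gamma\delta}$; it is strongly graded if $R_\gamma R_\delta=R_{\gamma\delta}$ for all $\gamma,\delta\in\Gamma$. $R_e$ is a subring of $R$. $\mathcal P\mathrm{gr}(R)$ is the category of $\Gamma$-graded left $R$-modules ($M=\bigoplus_{\gamma\in\Gamma}M_\gamma$, $R_\gamma M_\delta\subseteq M_{\gamma\delta}$) that are finitely generated and projective, with degree-preserving $R$-module homomorphisms. $K_0^{\mathrm{gr}}(R)=K_0(\mathcal P\mathrm{gr}(R))$ is the abelian group generated by the isomorphism classes $[P]$ of objects subject to $[P]=[P_1]+[P_2]$ for each short exact sequence $0\to P_1\to P\to P_2\to 0$ in $\mathcal P\mathrm{gr}(R)$. $K_0(R_e)$ is the usual $K_0$ of the ring $R_e$. *)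

theory Defs
  imports "HOL-Algebra.Algebra"
begin

section \<open>Left modules over a ring\<close>

text \<open>The locale \<open>module\<close> of the library requires the ring of scalars to be commutative.  The
  following has the same axioms over an arbitrary unital ring.  As for \<open>module\<close>, the
  multiplicative fields of the record \<open>M\<close> are irrelevant.\<close>

locale left_module = R?: ring R + M?: abelian_group M
  for R :: "('a, 'x) ring_scheme" (structure) and M :: "('a, 'b, 'y) module_scheme" (structure) +
  assumes smult_closed [simp, intro]:
      "\<lbrakk>a \<in> carrier R; x \<in> carrier M\<rbrakk> \<Longrightarrow> a \<odot>\<^bsub>M\<^esub> x \<in> carrier M"
    and smult_l_distr:
      "\<lbrakk>a \<in> carrier R; b \<in> carrier R; x \<in> carrier M\<rbrakk> \<Longrightarrow>
        (a \<oplus> b) \<odot>\<^bsub>M\<^esub> x = a \<odot>\<^bsub>M\<^esub> x \<oplus>\<^bsub>M\<^esub> b \<odot>\<^bsub>M\<^esub> x"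
    and smult_r_distr:
      "\<lbrakk>a \<in> carrier R; x \<in> carrier M; y \<in> carrier M\<rbrakk> \<Longrightarrow>
        a \<odot>\<^bsub>M\<^esub> (x \<oplus>\<^bsub>M\<^esub> y) = a \<odot>\<^bsub>M\<^esub> x \<oplus>\<^bsub>M\<^esub> a \<odot>\<^bsub>M\<^esub> y"
    and smult_assoc1:
      "\<lbrakk>a \<in> carrier R; b \<in> carrier R; x \<in> carrier M\<rbrakk> \<Longrightarrow>
        (a \<otimes> b) \<odot>\<^bsub>M\<^esub> x = a \<odot>\<^bsub>M\<^esub> (b \<odot>\<^bsub>M\<^esub> x)"
    and smult_one [simp]:
      "x \<in> carrier M \<Longrightarrow> \<one> \<odot>\<^bsub>M\<^esub> x = x"

definition left_module_hom ::
  "('r, 'x) ring_scheme \<Rightarrow> ('r, 'm, 'y) module_scheme \<Rightarrow> ('r, 'n, 'z) module_scheme \<Rightarrow> ('m \<Rightarrow> 'n) set"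
  where "left_module_hom R M N =
    {f. f \<in> carrier M \<rightarrow> carrier N \<and>
        (\<forall>x\<in>carrier M. \<forall>y\<in>carrier M. f (x \<oplus>\<^bsub>M\<^esub> y) = f x \<oplus>\<^bsub>N\<^esub> f y) \<and>
        (\<forall>a\<in>carrier R. \<forall>x\<in>carrier M. f (a \<odot>\<^bsub>M\<^esub> x) = a \<odot>\<^bsub>N\<^esub> f x)}"

definition finitely_generated ::
  "('r, 'x) ring_scheme \<Rightarrow> ('r, 'm, 'y) module_scheme \<Rightarrow> bool"
  where "finitely_generated R M \<longleftrightarrow>
    (\<exists>S. finite S \<and> S \<subseteq> carrier M \<and>
      (\<forall>x\<in>carrier M. \<exists>c \<in> S \<rightarrow> carrier R. x = (\<Oplus>\<^bsub>M\<^esub>s\<in>S. c s \<odot>\<^bsub>M\<^esub> s)))"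

text \<open>Projectivity is the lifting property against surjective homomorphisms \<open>g\<close>.  HOL cannot
  quantify over the types of the test modules \<open>M\<close> and \<open>N\<close>, so their elements are taken from
  \<open>nat \<Rightarrow> 'r\<close>.  For finitely generated \<open>P\<close>, the only ones considered below, this
  is no restriction: this type contains \<open>R\<^sup>n\<close> for every \<open>n\<close> and (as transported structures) all
  finitely generated modules, so lifting the identity through a surjection from \<open>R\<^sup>n\<close> onto a copy
  of \<open>P\<close> makes \<open>P\<close> a direct summand of \<open>R\<^sup>n\<close>, and then \<open>P\<close> lifts against all surjections.\<close>

definition projective_module ::
  "('r, 'x) ring_scheme \<Rightarrow> ('r, 'm, 'y) module_scheme \<Rightarrow> bool"
  where "projective_module R P \<longleftrightarrow>
    (\<forall>(M :: ('r, nat \<Rightarrow> 'r) module) (N :: ('r, nat \<Rightarrow> 'r) module) g f.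
      left_module R M \<and> left_module R N \<and>
      g \<in> left_module_hom R M N \<and> g ` carrier M = carrier N \<and> f \<in> left_module_hom R P N \<longrightarrow>
      (\<exists>h \<in> left_module_hom R P M. \<forall>x\<in>carrier P. g (h x) = f x))"

definition short_exact ::
  "('l, 'a, 'x) module_scheme \<Rightarrow> ('l, 'b, 'y) module_scheme \<Rightarrow> ('l, 'c, 'z) module_scheme \<Rightarrow>
    ('a \<Rightarrow> 'b) \<Rightarrow> ('b \<Rightarrow> 'c) \<Rightarrow> bool"
  \<comment> \<open>exactness of \<open>0 \<rightarrow> L \<rightarrow> M \<rightarrow> N \<rightarrow> 0\<close> with maps \<open>f\<close> and \<open>g\<close>\<close>
  where "short_exact L M N f g \<longleftrightarrow>
    inj_on f (carrier L) \<and> f ` carrier L = {x \<in> carrier M. g x = \<zero>\<^bsub>N\<^esub>} \<and>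
    g ` carrier M = carrier N"

section \<open>Grothendieck groups\<close>

text \<open>The abelian group generated by the isomorphism classes of objects, subject to
  \<open>[P] = [P1] + [P2]\<close> whenever \<open>ses P1 P P2\<close>.\<close>

definition iso_class :: "'o set \<Rightarrow> ('o \<Rightarrow> 'o \<Rightarrow> bool) \<Rightarrow> 'o \<Rightarrow> 'o set"
  where "iso_class Ob isom P = {Q \<in> Ob. isom P Q}"

definition Grothendieck_group ::
  "'o set \<Rightarrow> ('o \<Rightarrow> 'o \<Rightarrow> bool) \<Rightarrow> ('o \<Rightarrow> 'o \<Rightarrow> 'o \<Rightarrow> bool) \<Rightarrow> ('o set \<Rightarrow>\<^sub>0 int) set monoid"
  where "Grothendieck_group Ob isom ses =
    (let cl = iso_class Ob isom; F = free_Abelian_group (cl ` Ob)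
     in F Mod generate F
          {frag_of (cl P) - (frag_of (cl P1) + frag_of (cl P2)) | P1 P P2.
             P1 \<in> Ob \<and> P \<in> Ob \<and> P2 \<in> Ob \<and> ses P1 P P2})"

text \<open>In order to have a set of isomorphism classes, elements of modules over a ring with elements
  in \<open>'r\<close> are again taken from \<open>nat \<Rightarrow> 'r\<close>.  Every finitely generated projective module embeds as
  a set into this type, being a submodule of some \<open>R\<^sup>n\<close>, and its structure (including a grading,
  if there is one) can be transported along the embedding.  Hence every such module is isomorphic
  to one with elements in \<open>nat \<Rightarrow> 'r\<close>.\<close>

definition fg_projectives :: "('r, 'x) ring_scheme \<Rightarrow> ('r, nat \<Rightarrow> 'r) module set"
  where "fg_projectives R =
    {P. left_module R P \<and> finitely_generated R P \<and> projective_module R P}"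

definition K0 :: "('r, 'x) ring_scheme \<Rightarrow> (('r, nat \<Rightarrow> 'r) module set \<Rightarrow>\<^sub>0 int) set monoid"
  where "K0 R = Grothendieck_group (fg_projectives R)
    (\<lambda>P Q. \<exists>f \<in> left_module_hom R P Q. bij_betw f (carrier P) (carrier Q))
    (\<lambda>P1 P P2. \<exists>f \<in> left_module_hom R P1 P. \<exists>g \<in> left_module_hom R P P2. short_exact P1 P P2 f g)"

section \<open>Graded rings and graded modules\<close>

definition internal_direct_sum :: "('a, 'x) ring_scheme \<Rightarrow> 'i set \<Rightarrow> ('i \<Rightarrow> 'a set) \<Rightarrow> bool"
  where "internal_direct_sum M I S \<longleftrightarrow>
    (\<forall>i\<in>I. additive_subgroup (S i) M) \<and>
    (\<forall>x\<in>carrier M. \<exists>!c. c \<in> (\<Pi>\<^sub>E i\<in>I. S i) \<and> finite {i\<in>I. c i \<noteq> \<zero>\<^bsub>M\<^esub>} \<and>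
       x = (\<Oplus>\<^bsub>M\<^esub>i\<in>{i\<in>I. c i \<noteq> \<zero>\<^bsub>M\<^esub>}. c i))"

text \<open>The grading group is called \<open>G\<close>; \<open>A \<gamma>\<close> is the homogeneous component of degree \<open>\<gamma>\<close>.\<close>

definition graded_ring ::
  "('g, 'x) monoid_scheme \<Rightarrow> ('r, 'y) ring_scheme \<Rightarrow> ('g \<Rightarrow> 'r set) \<Rightarrow> bool"
  where "graded_ring G R A \<longleftrightarrow>
    group G \<and> ring R \<and> internal_direct_sum R (carrier G) A \<and>
    (\<forall>\<gamma>\<in>carrier G. \<forall>\<delta>\<in>carrier G. \<forall>a\<in>A \<gamma>. \<forall>b\<in>A \<delta>. a \<otimes>\<^bsub>R\<^esub> b \<in> A (\<gamma> \<otimes>\<^bsub>G\<^esub> \<delta>))"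

text \<open>The product of two additive subgroups consists of the finite sums of products.\<close>

definition additive_prod :: "('r, 'y) ring_scheme \<Rightarrow> 'r set \<Rightarrow> 'r set \<Rightarrow> 'r set"
  where "additive_prod R B C = generate (add_monoid R) {b \<otimes>\<^bsub>R\<^esub> c | b c. b \<in> B \<and> c \<in> C}"

definition strongly_graded ::
  "('g, 'x) monoid_scheme \<Rightarrow> ('r, 'y) ring_scheme \<Rightarrow> ('g \<Rightarrow> 'r set) \<Rightarrow> bool"
  where "strongly_graded G R A \<longleftrightarrow>
    (\<forall>\<gamma>\<in>carrier G. \<forall>\<delta>\<in>carrier G. additive_prod R (A \<gamma>) (A \<delta>) = A (\<gamma> \<otimes>\<^bsub>G\<^esub> \<delta>))"

definition identity_component ::
  "('g, 'x) monoid_scheme \<Rightarrow> ('r, 'y) ring_scheme \<Rightarrow> ('g \<Rightarrow> 'r set) \<Rightarrow> ('r, 'y) ring_scheme"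
  where "identity_component G R A = R\<lparr>carrier := A \<one>\<^bsub>G\<^esub>\<rparr>"

record ('g, 'r, 'm) graded_module = "('r, 'm) module" +
  component :: "'g \<Rightarrow> 'm set"

definition is_graded_module ::
  "('g, 'x) monoid_scheme \<Rightarrow> ('r, 'y) ring_scheme \<Rightarrow> ('g \<Rightarrow> 'r set) \<Rightarrow>
    ('g, 'r, 'm) graded_module \<Rightarrow> bool"
  where "is_graded_module G R A M \<longleftrightarrow>
    left_module R M \<and> internal_direct_sum M (carrier G) (component M) \<and>
    (\<forall>\<gamma>\<in>carrier G. \<forall>\<delta>\<in>carrier G. \<forall>a\<in>A \<gamma>. \<forall>x\<in>component M \<delta>.
      a \<odot>\<^bsub>M\<^esub> x \<in> component M (\<gamma> \<otimes>\<^bsub>G\<^esub> \<delta>))"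

definition graded_hom ::
  "('g, 'x) monoid_scheme \<Rightarrow> ('r, 'y) ring_scheme \<Rightarrow>
    ('g, 'r, 'm) graded_module \<Rightarrow> ('g, 'r, 'n) graded_module \<Rightarrow> ('m \<Rightarrow> 'n) set"
  where "graded_hom G R M N =
    {f \<in> left_module_hom R M N. \<forall>\<gamma>\<in>carrier G. f ` component M \<gamma> \<subseteq> component N \<gamma>}"

definition graded_fg_projectives ::
  "('g, 'x) monoid_scheme \<Rightarrow> ('r, 'y) ring_scheme \<Rightarrow> ('g \<Rightarrow> 'r set) \<Rightarrow>
    ('g, 'r, nat \<Rightarrow> 'r) graded_module set"
  where "graded_fg_projectives G R A =
    {P. is_graded_module G R A P \<and> finitely_generated R P \<and> projective_module R P}"

text \<open>The inverse of a bijective degree-preserving homomorphism of graded modules preserves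
  degrees, so the bijective ones are the isomorphisms.\<close>

definition K0_gr ::
  "('g, 'x) monoid_scheme \<Rightarrow> ('r, 'y) ring_scheme \<Rightarrow> ('g \<Rightarrow> 'r set) \<Rightarrow>
    (('g, 'r, nat \<Rightarrow> 'r) graded_module set \<Rightarrow>\<^sub>0 int) set monoid"
  where "K0_gr G R A = Grothendieck_group (graded_fg_projectives G R A)
    (\<lambda>P Q. \<exists>f \<in> graded_hom G R P Q. bij_betw f (carrier P) (carrier Q))
    (\<lambda>P1 P P2. \<exists>f \<in> graded_hom G R P1 P. \<exists>g \<in> graded_hom G R P P2. short_exact P1 P P2 f g)"

end

theory Submission
  imports Defs
begin

text \<open>The functor \<open>P \<mapsto> P\<^sub>e\<close> induces the isomorphism. Since \<open>\<one>\<close> lies in the product of the components of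
  \<open>R\<close> of degrees \<open>\<gamma>\<close> and inverse to \<open>\<gamma>\<close>, an element \<open>x\<close> of degree \<open>\<gamma>\<close> lies in a submodule as soon as
  all its multiples \<open>v x \<in> P\<^sub>e\<close> do. Hence graded submodules are determined by their identity
  components, so that exactness can be tested there, and every \<open>R\<^sub>e\<close>-linear map \<open>P\<^sub>e \<rightarrow> Q\<^sub>e\<close>
  extends to a graded homomorphism \<open>P \<rightarrow> Q\<close>. For the same reason a finitely generated graded \<open>P\<close> is
  generated by finitely many elements of \<open>P\<^sub>e\<close>, and the degree \<open>e\<close> part of a dual basis of \<open>P\<close> is one
  of \<open>P\<^sub>e\<close>. Conversely, a finitely generated projective \<open>R\<^sub>e\<close>-module is the image of an idempotent
  matrix over \<open>R\<^sub>e\<close>, hence the identity component of the image of this matrix over \<open>R\<close>.\<close>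

section \<open>Isomorphisms of Grothendieck groups\<close>

text \<open>The equivalence of categories in the background is Dade's theorem, whose usual inverse
  functor is \<open>R\<close> tensored over \<open>R\<^sub>e\<close> with an
  \<open>R\<^sub>e\<close>-module. A tensor product would be a quotient, whereas objects here must
  have elements in \<open>nat \<Rightarrow> 'r\<close>. On objects, the image of an idempotent
  matrix is a substitute that already consists of sequences in \<open>R\<close>. On maps, only
  existence matters: a Grothendieck group sees its category through two relations, being isomorphic
  and forming a short exact sequence. It is enough that these are preserved and reflected and that
  every isomorphism class is reached. Both relations ask for maps subject to injectivity,
  surjectivity and equality of an image with a kernel, so the extension of a map from degree
  \<open>e\<close> has to inherit exactly these properties.\<close>

lemma Mod_iso:
  assumes "group H" "N \<lhd> H" "\<phi> \<in> iso G H" "group G" "\<phi> ` K = N" "K \<subseteq> carrier G"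
  shows "G Mod K \<cong> H Mod N"
proof -
  interpret N: normal N H by fact
  interpret GH: group_hom G H \<phi>
    using assms by (auto simp: group_hom_def group_hom_axioms_def iso_def)
  \<comment> \<open>The composite of \<open>\<phi>\<close> with the quotient map is onto;
    injectivity of \<open>\<phi>\<close> makes \<open>K\<close> its whole kernel, and the first
    isomorphism theorem applies.\<close>
  let ?h = "\<lambda>x. N #>\<^bsub>H\<^esub> \<phi> x"
  have hom: "?h \<in> hom G (H Mod N)"
    using hom_compose[OF GH.homh N.r_coset_hom_Mod] by (simp add: o_def)
  interpret h: group_hom G "H Mod N" ?h
    using hom assms N.factorgroup_is_group by (auto simp: group_hom_def group_hom_axioms_def)
  have inj: "inj_on \<phi> (carrier G)" and surj: "\<phi> ` carrier G = carrier H"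
    using assms by (auto simp: iso_def bij_betw_def)
  have "kernel G (H Mod N) ?h = {x \<in> carrier G. \<phi> x \<in> N}"
  proof -
    have "N #>\<^bsub>H\<^esub> y = N \<longleftrightarrow> y \<in> N" if "y \<in> carrier H" for y
      using that N.rcos_const[OF assms(1), of y] N.rcos_self[OF that N.subgroup_axioms] by auto
    then show ?thesis unfolding kernel_def by (simp cong: conj_cong)
  qed
  also have "\<dots> = K"
    using inj assms(5,6) by (auto simp: inj_on_def)
  finally have ker: "kernel G (H Mod N) ?h = K" .
  have "?h ` carrier G = carrier (H Mod N)"
    by (simp add: carrier_FactGroup image_image flip: surj)
  from h.FactGroup_iso[OF this] show ?thesis by (simp add: ker)
qed

text \<open>Free abelian groups are functorial in their generators: the extension of the inverse
  bijection undoes that of \<open>\<beta>\<close>, as both composites fix the generators.\<close>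

lemma iso_free_Abelian_group:
  assumes "bij_betw \<beta> S T"
  shows "frag_extend (frag_of \<circ> \<beta>) \<in> iso (free_Abelian_group S) (free_Abelian_group T)"
proof -
  let ?\<phi> = "frag_extend (frag_of \<circ> \<beta>)" and ?\<psi> = "frag_extend (frag_of \<circ> inv_into S \<beta>)"
  have hom: "frag_extend (frag_of \<circ> b) \<in> hom (free_Abelian_group U) (free_Abelian_group Y)"
    if "b ` U \<subseteq> Y" for b :: "'x \<Rightarrow> 'y" and U Y
  proof (rule homI)
    fix c assume "c \<in> carrier (free_Abelian_group U)"
    then have "(\<Union>x\<in>Poly_Mapping.keys c. Poly_Mapping.keys ((frag_of \<circ> b) x)) \<subseteq> Y"
      using that by auto
    then show "frag_extend (frag_of \<circ> b) c \<in> carrier (free_Abelian_group Y)"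
      using keys_frag_extend[of "frag_of \<circ> b" c] by simp
  qed (simp add: frag_extend_add)
  have inv: "frag_extend (frag_of \<circ> b') (frag_extend (frag_of \<circ> b) c) = c"
    if "\<And>x. x \<in> U \<Longrightarrow> b' (b x) = x" "Poly_Mapping.keys c \<subseteq> U"
    for b :: "'x \<Rightarrow> 'y" and b' U c
    using that(2)
  proof (induction c rule: frag_induction)
    case (diff a b)
    then show ?case by (simp add: frag_extend_diff)
  qed (use that in auto)
  have sub: "\<beta> ` S \<subseteq> T" and sub': "inv_into S \<beta> ` T \<subseteq> S"
    using assms by (auto simp: bij_betw_def inv_into_into)
  show ?thesis
  proof (rule isoI[OF hom[OF sub]])
    show "bij_betw ?\<phi> (carrier (free_Abelian_group S)) (carrier (free_Abelian_group T))"
    proof (rule bij_betw_byWitness[where f' = ?\<psi>])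
      show "\<forall>c\<in>carrier (free_Abelian_group S). ?\<psi> (?\<phi> c) = c"
        using inv[of S "inv_into S \<beta>" \<beta>] assms by (auto simp: bij_betw_def)
      show "\<forall>c\<in>carrier (free_Abelian_group T). ?\<phi> (?\<psi> c) = c"
        using inv[of T \<beta> "inv_into S \<beta>"] assms by (auto simp: bij_betw_def f_inv_into_f)
      show "?\<phi> ` carrier (free_Abelian_group S) \<subseteq> carrier (free_Abelian_group T)"
        using hom[OF sub] by (auto simp only: hom_def)
      show "?\<psi> ` carrier (free_Abelian_group T) \<subseteq> carrier (free_Abelian_group S)"
        using hom[OF sub'] by (auto simp only: hom_def)
    qed
  qed
qed

text \<open>The hypotheses are what remains of an equivalence of categories once the morphisms are
  forgotten. \<open>\<Phi>\<close> then induces a bijection of isomorphism classes that carries the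
  defining relations of one group onto those of the other. \<open>ses_isom\<close> is there because
  an exact sequence in \<open>Ob'\<close> need not consist of objects \<open>\<Phi> P\<close>;
  replacing its terms by isomorphic ones of that form leaves its relation unchanged.\<close>

lemma Grothendieck_group_iso:
  fixes \<Phi> :: "'o \<Rightarrow> 'p"
  assumes Phi: "\<And>P. P \<in> Ob \<Longrightarrow> \<Phi> P \<in> Ob'"
    and ess_surj: "\<And>Q. Q \<in> Ob' \<Longrightarrow> \<exists>P\<in>Ob. isom' (\<Phi> P) Q"
    and refl: "\<And>P. P \<in> Ob' \<Longrightarrow> isom' P P"
    and sym: "\<And>P Q. \<lbrakk>P \<in> Ob'; Q \<in> Ob'; isom' P Q\<rbrakk> \<Longrightarrow> isom' Q P"
    and trans: "\<And>P Q T. \<lbrakk>P \<in> Ob'; Q \<in> Ob'; T \<in> Ob'; isom' P Q; isom' Q T\<rbrakk> \<Longrightarrow> isom' P T"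
    and isom: "\<And>P Q. \<lbrakk>P \<in> Ob; Q \<in> Ob\<rbrakk> \<Longrightarrow> isom P Q \<longleftrightarrow> isom' (\<Phi> P) (\<Phi> Q)"
    and ses: "\<And>P1 P P2. \<lbrakk>P1 \<in> Ob; P \<in> Ob; P2 \<in> Ob\<rbrakk> \<Longrightarrow>
      ses P1 P P2 \<longleftrightarrow> ses' (\<Phi> P1) (\<Phi> P) (\<Phi> P2)"
    and ses_isom: "\<And>P1 P P2 Q1 Q Q2. \<lbrakk>P1 \<in> Ob'; P \<in> Ob'; P2 \<in> Ob'; Q1 \<in> Ob'; Q \<in> Ob'; Q2 \<in> Ob';
      isom' P1 Q1; isom' P Q; isom' P2 Q2; ses' P1 P P2\<rbrakk> \<Longrightarrow> ses' Q1 Q Q2"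
  shows "Grothendieck_group Ob isom ses \<cong> Grothendieck_group Ob' isom' ses'"
proof -
  let ?c = "iso_class Ob isom" and ?c' = "iso_class Ob' isom'"
  let ?F = "free_Abelian_group (?c ` Ob)" and ?F' = "free_Abelian_group (?c' ` Ob')"
  have c': "?c' P = ?c' Q \<longleftrightarrow> isom' P Q" if "P \<in> Ob'" "Q \<in> Ob'" for P Q
  proof
    assume "?c' P = ?c' Q"
    moreover have "Q \<in> ?c' Q" using that refl by (simp add: iso_class_def)
    ultimately show "isom' P Q" by (auto simp: iso_class_def)
  next
    assume "isom' P Q"
    then have "isom' P T \<longleftrightarrow> isom' Q T" if "T \<in> Ob'" for T
      using that \<open>P \<in> Ob'\<close> \<open>Q \<in> Ob'\<close> sym trans by metis
    then show "?c' P = ?c' Q" by (auto simp: iso_class_def)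
  qed
  have c: "?c P = ?c Q \<longleftrightarrow> ?c' (\<Phi> P) = ?c' (\<Phi> Q)" if "P \<in> Ob" "Q \<in> Ob" for P Q
  proof -
    have "?c P = ?c Q \<longleftrightarrow> isom P Q"
    proof
      assume "?c P = ?c Q"
      moreover have "Q \<in> ?c Q"
        using that isom[of Q Q] Phi refl by (simp add: iso_class_def)
      ultimately show "isom P Q" by (auto simp: iso_class_def)
    next
      assume "isom P Q"
      then have "isom' (\<Phi> P) (\<Phi> Q)" using that isom by simp
      then have "isom' (\<Phi> P) (\<Phi> T) \<longleftrightarrow> isom' (\<Phi> Q) (\<Phi> T)" if "T \<in> Ob" for T
        using that \<open>P \<in> Ob\<close> \<open>Q \<in> Ob\<close> Phi sym trans by metis
      then show "?c P = ?c Q"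
        using that isom by (auto simp: iso_class_def)
    qed
    then show ?thesis using that c' isom Phi by simp
  qed
  \<comment> \<open>A representative of the class \<open>U\<close> is chosen; by \<open>c\<close>
    the class of its image does not depend on the choice.\<close>
  define \<beta> where "\<beta> U = ?c' (\<Phi> (SOME P. P \<in> Ob \<and> ?c P = U))" for U
  have \<beta>: "\<beta> (?c P) = ?c' (\<Phi> P)" if "P \<in> Ob" for P
  proof -
    have "(SOME Q. Q \<in> Ob \<and> ?c Q = ?c P) \<in> Ob \<and> ?c (SOME Q. Q \<in> Ob \<and> ?c Q = ?c P) = ?c P"
      by (rule someI[where x = P]) (use that in simp)
    then show ?thesis unfolding \<beta>_def using that c by blast
  qed
  have "\<beta> ` ?c ` Ob = ?c' ` Ob'"
  proof
    show "?c' ` Ob' \<subseteq> \<beta> ` ?c ` Ob"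
    proof safe
      fix Q assume Q: "Q \<in> Ob'"
      then obtain P where "P \<in> Ob" "isom' (\<Phi> P) Q" using ess_surj by blast
      then have "?c' (\<Phi> P) = ?c' Q" using c' Phi Q by simp
      then have "?c' Q = \<beta> (?c P)" using \<beta> \<open>P \<in> Ob\<close> by simp
      then show "?c' Q \<in> \<beta> ` ?c ` Ob" using \<open>P \<in> Ob\<close> by blast
    qed
  qed (use \<beta> Phi in auto)
  moreover have "inj_on \<beta> (?c ` Ob)"
    by (simp add: inj_on_def \<beta> c)
  ultimately have bij: "bij_betw \<beta> (?c ` Ob) (?c' ` Ob')"
    by (simp add: bij_betw_def)
  define \<phi> where "\<phi> = frag_extend (frag_of \<circ> \<beta>)"
  have iso: "\<phi> \<in> iso ?F ?F'"
    unfolding \<phi>_def by (rule iso_free_Abelian_group[OF bij])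
  define rel where "rel P1 P P2 = frag_of (?c P) - (frag_of (?c P1) + frag_of (?c P2))" for P1 P P2
  define rel' where "rel' P1 P P2 = frag_of (?c' P) - (frag_of (?c' P1) + frag_of (?c' P2))" for P1 P P2
  define U where "U = {rel P1 P P2 | P1 P P2. P1 \<in> Ob \<and> P \<in> Ob \<and> P2 \<in> Ob \<and> ses P1 P P2}"
  define U' where "U' = {rel' P1 P P2 | P1 P P2. P1 \<in> Ob' \<and> P \<in> Ob' \<and> P2 \<in> Ob' \<and> ses' P1 P P2}"
  have \<phi>_rel: "\<phi> (rel P1 P P2) = rel' (\<Phi> P1) (\<Phi> P) (\<Phi> P2)"
    if "P1 \<in> Ob" "P \<in> Ob" "P2 \<in> Ob" for P1 P P2
    using that by (simp add: \<phi>_def rel_def rel'_def frag_extend_diff frag_extend_add \<beta>)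
  have "\<phi> ` U = U'"
  proof
    show "\<phi> ` U \<subseteq> U'"
      using \<phi>_rel ses Phi unfolding U_def U'_def by blast
    show "U' \<subseteq> \<phi> ` U"
    proof
      fix x assume "x \<in> U'"
      then obtain Q1 Q Q2 where Q: "x = rel' Q1 Q Q2" "Q1 \<in> Ob'" "Q \<in> Ob'" "Q2 \<in> Ob'" "ses' Q1 Q Q2"
        unfolding U'_def by blast
      obtain P1 P P2 where P: "P1 \<in> Ob" "P \<in> Ob" "P2 \<in> Ob"
        and i: "isom' (\<Phi> P1) Q1" "isom' (\<Phi> P) Q" "isom' (\<Phi> P2) Q2"
        using ess_surj[OF Q(2)] ess_surj[OF Q(3)] ess_surj[OF Q(4)] by blast
      have "ses' (\<Phi> P1) (\<Phi> P) (\<Phi> P2)"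
        by (rule ses_isom[of Q1 Q Q2]) (use Q P i Phi sym in auto)
      then have "rel P1 P P2 \<in> U"
        using P ses unfolding U_def by blast
      moreover have "x = \<phi> (rel P1 P P2)"
      proof -
        have "?c' (\<Phi> P1) = ?c' Q1" "?c' (\<Phi> P) = ?c' Q" "?c' (\<Phi> P2) = ?c' Q2"
          using c' Phi P Q i by simp_all
        then show ?thesis using P by (simp add: \<phi>_rel) (simp add: rel'_def Q)
      qed
      ultimately show "x \<in> \<phi> ` U" by blast
    qed
  qed
  have U_sub: "U \<subseteq> carrier ?F"
  proof
    fix x assume "x \<in> U"
    then obtain P1 P P2 where "x = rel P1 P P2" "P1 \<in> Ob" "P \<in> Ob" "P2 \<in> Ob"
      unfolding U_def by blast
    moreover from this have "Poly_Mapping.keys x \<subseteq> {?c P} \<union> ({?c P1} \<union> {?c P2})"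
      unfolding rel_def using keys_diff[of "frag_of (?c P)" "frag_of (?c P1) + frag_of (?c P2)"] Poly_Mapping.keys_add[of "frag_of (?c P1)" "frag_of (?c P2)"]
      by auto
    ultimately show "x \<in> carrier ?F" by auto
  qed
  interpret F: comm_group ?F by (rule abelian_free_Abelian_group)
  interpret F': comm_group ?F' by (rule abelian_free_Abelian_group)
  interpret \<phi>: group_hom ?F ?F' \<phi>
    using iso by (auto simp: group_hom_def group_hom_axioms_def iso_def)
  have U'_sub: "U' \<subseteq> carrier ?F'"
    using \<open>\<phi> ` U = U'\<close> U_sub \<phi>.hom_closed by blast
  have "?F Mod generate ?F U \<cong> ?F' Mod generate ?F' U'"
  proof (rule Mod_iso)
    show "generate ?F' U' \<lhd> ?F'"
      by (rule F'.normal_iff_subgroup[THEN iffD2]) (rule F'.generate_is_subgroup[OF U'_sub])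
    show "\<phi> ` generate ?F U = generate ?F' U'"
      using \<phi>.generate_img[OF U_sub] \<open>\<phi> ` U = U'\<close> by simp
    show "generate ?F U \<subseteq> carrier ?F"
      using F.generate_incl[OF U_sub] .
  qed (use iso in simp_all)
  then show ?thesis
    unfolding Grothendieck_group_def Let_def U_def U'_def rel_def rel'_def .
qed

section \<open>Internal direct sums\<close>

text \<open>Infinite \<open>A\<close> is covered too: a sum over it is zero by convention, and
  \<open>h\<close> preserves zero.\<close>

lemma (in abelian_group_hom) hom_finsum:
  assumes "f \<in> A \<rightarrow> carrier G"
  shows "h (\<Oplus>\<^bsub>G\<^esub>i\<in>A. f i) = (\<Oplus>\<^bsub>H\<^esub>i\<in>A. h (f i))"
  using assms
proof (induction A rule: infinite_finite_induct)
  case (insert x F)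
  then have "f x \<in> carrier G" "f \<in> F \<rightarrow> carrier G" by auto
  then show ?case
    using insert by (simp add: G.finsum_insert H.finsum_insert G.finsum_closed Pi_iff)
qed (simp_all add: G.finsum_infinite H.finsum_infinite)

lemma (in abelian_monoid) finsum_in_closed_set:
  assumes "\<zero> \<in> L" "\<And>x y. \<lbrakk>x \<in> L; y \<in> L\<rbrakk> \<Longrightarrow> x \<oplus> y \<in> L" "L \<subseteq> carrier G"
    and "\<And>i. i \<in> A \<Longrightarrow> f i \<in> L"
  shows "(\<Oplus>i\<in>A. f i) \<in> L"
  using assms(4)
proof (induction A rule: infinite_finite_induct)
  case (insert x F)
  then have "f x \<in> carrier G" "f \<in> F \<rightarrow> carrier G" using assms(3) by auto
  then show ?case using insert assms(2) by (simp add: finsum_insert)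
qed (simp_all add: finsum_infinite assms(1))

lemma (in abelian_monoid) finsum_only:
  assumes "j \<in> A" "finite A" "f j \<in> carrier G" "\<And>i. \<lbrakk>i \<in> A; i \<noteq> j\<rbrakk> \<Longrightarrow> f i = \<zero>"
  shows "(\<Oplus>i\<in>A. f i) = f j"
proof -
  have "(\<Oplus>i\<in>A. f i) = (\<Oplus>i\<in>A. if j = i then f i else \<zero>)"
    by (rule finsum_cong') (use assms in auto)
  moreover have "f i \<in> carrier G" if "i \<in> A" for i
    using assms(3,4) that by (cases "i = j") auto
  ultimately show ?thesis using finsum_singleton[OF assms(1,2), of f] by auto
qed

text \<open>The homogeneous part of \<open>x\<close> of index \<open>i\<close>. The decomposition is
  sought among functions that are \<open>undefined\<close> outside \<open>I\<close>, since only then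
  is it unique; for \<open>x\<close> in a direct sum the description is proper.\<close>

definition part :: "('a, 'x) ring_scheme \<Rightarrow> 'i set \<Rightarrow> ('i \<Rightarrow> 'a set) \<Rightarrow> 'i \<Rightarrow> 'a \<Rightarrow> 'a"
  where "part M I S i x = (THE c. c \<in> (\<Pi>\<^sub>E i\<in>I. S i) \<and> finite {i\<in>I. c i \<noteq> \<zero>\<^bsub>M\<^esub>} \<and>
       x = (\<Oplus>\<^bsub>M\<^esub>i\<in>{i\<in>I. c i \<noteq> \<zero>\<^bsub>M\<^esub>}. c i)) i"

locale direct_sum = abelian_group M for M :: "('a, 'x) ring_scheme" (structure) +
  fixes I :: "'i set" and S :: "'i \<Rightarrow> 'a set"
  assumes decomposition: "internal_direct_sum M I S"
begin

abbreviation "pr \<equiv> part M I S"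

lemma summand_subgroup: "i \<in> I \<Longrightarrow> additive_subgroup (S i) M"
  using decomposition by (simp add: internal_direct_sum_def)

lemma summand_closed: "\<lbrakk>i \<in> I; x \<in> S i\<rbrakk> \<Longrightarrow> x \<in> carrier M"
  using summand_subgroup additive_subgroup.a_Hcarr by metis

lemma summand_zero: "i \<in> I \<Longrightarrow> \<zero> \<in> S i"
  using summand_subgroup additive_subgroup.zero_closed by metis

lemma summand_add: "\<lbrakk>i \<in> I; x \<in> S i; y \<in> S i\<rbrakk> \<Longrightarrow> x \<oplus> y \<in> S i"
  using summand_subgroup additive_subgroup.a_closed by metis

lemma parts_decomposition:
  assumes "x \<in> carrier M"
  shows "(\<lambda>i\<in>I. pr i x) \<in> (\<Pi>\<^sub>E i\<in>I. S i)" "finite {i\<in>I. pr i x \<noteq> \<zero>}"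
    "x = (\<Oplus>i\<in>{i\<in>I. pr i x \<noteq> \<zero>}. pr i x)"
proof -
  have ex: "\<exists>!c. c \<in> (\<Pi>\<^sub>E i\<in>I. S i) \<and> finite {i\<in>I. c i \<noteq> \<zero>} \<and>
       x = (\<Oplus>i\<in>{i\<in>I. c i \<noteq> \<zero>}. c i)"
    using decomposition assms by (auto simp: internal_direct_sum_def)
  define c where "c = (THE c. c \<in> (\<Pi>\<^sub>E i\<in>I. S i) \<and> finite {i\<in>I. c i \<noteq> \<zero>} \<and>
       x = (\<Oplus>i\<in>{i\<in>I. c i \<noteq> \<zero>}. c i))"
  have pr: "pr i x = c i" for i by (simp add: part_def c_def)
  have c: "c \<in> (\<Pi>\<^sub>E i\<in>I. S i) \<and> finite {i\<in>I. c i \<noteq> \<zero>} \<and> x = (\<Oplus>i\<in>{i\<in>I. c i \<noteq> \<zero>}. c i)"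
    unfolding c_def by (rule theI'[OF ex])
  then have "c \<in> extensional I" by (simp add: PiE_def)
  then have "(\<lambda>i\<in>I. pr i x) = c"
    by (simp add: pr extensional_restrict)
  with c show "(\<lambda>i\<in>I. pr i x) \<in> (\<Pi>\<^sub>E i\<in>I. S i)" "finite {i\<in>I. pr i x \<noteq> \<zero>}"
    "x = (\<Oplus>i\<in>{i\<in>I. pr i x \<noteq> \<zero>}. pr i x)"
    unfolding pr by auto
qed

lemmas finite_parts = parts_decomposition(2)
lemmas sum_parts = parts_decomposition(3)

lemma part_in: "\<lbrakk>i \<in> I; x \<in> carrier M\<rbrakk> \<Longrightarrow> pr i x \<in> S i"
  using parts_decomposition(1)[of x] by (auto dest: PiE_mem)

lemma part_closed: "\<lbrakk>i \<in> I; x \<in> carrier M\<rbrakk> \<Longrightarrow> pr i x \<in> carrier M"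
  using part_in summand_closed by blast

lemma finsum_support:
  assumes "finite J" "J \<subseteq> I" "\<And>i. i \<in> I \<Longrightarrow> c i \<in> S i" "\<And>i. i \<in> I - J \<Longrightarrow> c i = \<zero>"
  shows "(\<Oplus>i\<in>{i\<in>I. c i \<noteq> \<zero>}. c i) = (\<Oplus>i\<in>J. c i)"
proof (rule add.finprod_mono_neutral_cong_left)
  show "c \<in> J \<rightarrow> carrier M" using assms summand_closed by blast
qed (use assms in auto)

text \<open>Dropping the zero coefficients from the sum over \<open>J\<close> and restricting to
  \<open>I\<close> turns \<open>c\<close> into a family of the kind whose uniqueness defines the
  parts.\<close>

lemma part_unique:
  assumes c: "\<And>i. i \<in> I \<Longrightarrow> c i \<in> S i" and J: "finite J" "J \<subseteq> I" "\<And>i. i \<in> I - J \<Longrightarrow> c i = \<zero>"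
    and x: "x = (\<Oplus>i\<in>J. c i)" and i: "i \<in> I"
  shows "pr i x = c i"
proof -
  let ?D = "\<lambda>c. c \<in> (\<Pi>\<^sub>E i\<in>I. S i) \<and> finite {i\<in>I. c i \<noteq> \<zero>} \<and> x = (\<Oplus>i\<in>{i\<in>I. c i \<noteq> \<zero>}. c i)"
  have xc: "x \<in> carrier M"
    unfolding x by (rule finsum_closed) (use c J summand_closed in blast)
  then have ex: "\<exists>!c. ?D c"
    using decomposition by (auto simp: internal_direct_sum_def)
  define r where "r c = restrict c I" for c :: "'i \<Rightarrow> 'a"
  have r: "{i\<in>I. r c i \<noteq> \<zero>} = {i\<in>I. c i \<noteq> \<zero>}"
    "c ` {i\<in>I. c i \<noteq> \<zero>} \<subseteq> carrier M \<Longrightarrow> (\<Oplus>i\<in>{i\<in>I. c i \<noteq> \<zero>}. r c i) = (\<Oplus>i\<in>{i\<in>I. c i \<noteq> \<zero>}. c i)" for c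
    by (auto simp: r_def intro!: finsum_cong')
  have "{i\<in>I. c i \<noteq> \<zero>} \<subseteq> J" using J by auto
  then have fin: "finite {i\<in>I. c i \<noteq> \<zero>}" using J finite_subset by blast
  have "?D (r c)"
    using c J x finsum_support[OF J(1,2) c J(3)] fin
    by (subst r)+ (auto simp: r_def intro: summand_closed)
  moreover have "?D (r (\<lambda>i. pr i x))"
    using parts_decomposition[OF xc] part_closed[OF _ xc] by (subst r)+ (auto simp: r_def)
  ultimately have "r c = r (\<lambda>i. pr i x)" using ex by blast
  then show ?thesis using i unfolding r_def by (metis restrict_apply')
qed

lemma sum_parts_superset:
  assumes "x \<in> carrier M" "finite J" "J \<subseteq> I" "{i\<in>I. pr i x \<noteq> \<zero>} \<subseteq> J"
  shows "x = (\<Oplus>i\<in>J. pr i x)"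
  using sum_parts[OF assms(1)] finsum_support[of J "\<lambda>i. pr i x"] assms part_in by auto

lemma part_add:
  assumes "x \<in> carrier M" "y \<in> carrier M" "i \<in> I"
  shows "pr i (x \<oplus> y) = pr i x \<oplus> pr i y"
proof -
  \<comment> \<open>Both sums are taken over the union of the supports; cancellation in
    \<open>x \<oplus> y\<close> does no harm, since \<open>part_unique\<close> admits zero
    coefficients.\<close>
  define J where "J = {i\<in>I. pr i x \<noteq> \<zero>} \<union> {i\<in>I. pr i y \<noteq> \<zero>}"
  have J: "finite J" "J \<subseteq> I" using assms finite_parts by (auto simp: J_def)
  have "x \<oplus> y = (\<Oplus>i\<in>J. pr i x) \<oplus> (\<Oplus>i\<in>J. pr i y)"
    using sum_parts_superset[OF assms(1) J] sum_parts_superset[OF assms(2) J] by (auto simp: J_def)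
  also have "\<dots> = (\<Oplus>i\<in>J. pr i x \<oplus> pr i y)"
    using assms J part_closed by (subst finsum_addf) auto
  finally show ?thesis
    using assms J by (intro part_unique[where J = J]) (auto simp: J_def intro: summand_add part_in)
qed

lemma part_hom: "i \<in> I \<Longrightarrow> abelian_group_hom M M (pr i)"
  by (rule abelian_group_homI) (use abelian_group_axioms part_closed part_add in
      \<open>auto simp: group_hom_def group_hom_axioms_def hom_def a_group\<close>)

lemma part_same: "\<lbrakk>i \<in> I; x \<in> S i\<rbrakk> \<Longrightarrow> pr i x = x"
  by (rule part_unique[where J = "{i}" and c = "\<lambda>j. if j = i then x else \<zero>", THEN trans])
    (auto simp: summand_zero summand_closed)

lemma part_other: "\<lbrakk>i \<in> I; j \<in> I; i \<noteq> j; x \<in> S j\<rbrakk> \<Longrightarrow> pr i x = \<zero>"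
  by (rule part_unique[where J = "{j}" and c = "\<lambda>k. if k = j then x else \<zero>", THEN trans])
    (auto simp: summand_zero summand_closed)

lemma part_zero: "i \<in> I \<Longrightarrow> pr i \<zero> = \<zero>"
  using part_same summand_zero by blast

lemma in_closed_set_if_parts:
  assumes "x \<in> carrier M" "\<And>i. i \<in> I \<Longrightarrow> pr i x \<in> L"
    and "\<zero> \<in> L" "\<And>x y. \<lbrakk>x \<in> L; y \<in> L\<rbrakk> \<Longrightarrow> x \<oplus> y \<in> L" "L \<subseteq> carrier M"
  shows "x \<in> L"
  by (subst sum_parts[OF assms(1)]) (rule finsum_in_closed_set, use assms in auto)

lemma homogeneous_induct [consumes 1, case_names zero add homogeneous]:
  assumes "x \<in> carrier M" "P \<zero>" "\<And>x y. \<lbrakk>x \<in> carrier M; y \<in> carrier M; P x; P y\<rbrakk> \<Longrightarrow> P (x \<oplus> y)"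
    and "\<And>i x. \<lbrakk>i \<in> I; x \<in> S i\<rbrakk> \<Longrightarrow> P x"
  shows "P x"
  using in_closed_set_if_parts[of x "{y \<in> carrier M. P y}"] assms part_in part_closed by auto

end

text \<open>Both sides are additive in \<open>x\<close>, so homogeneous \<open>x\<close> suffice,
  and injectivity of \<open>\<sigma>\<close> keeps distinct degrees apart. The reindexing is the
  identity for degree-preserving maps and a translation of the group for multiplication by a
  homogeneous element.\<close>

lemma part_image:
  assumes "direct_sum M I S" "direct_sum N J T" "abelian_group_hom M N h"
    and \<sigma>: "inj_on \<sigma> I" "\<sigma> ` I \<subseteq> J" and h: "\<And>i x. \<lbrakk>i \<in> I; x \<in> S i\<rbrakk> \<Longrightarrow> h x \<in> T (\<sigma> i)"
    and i: "i \<in> I" and x: "x \<in> carrier M"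
  shows "part N J T (\<sigma> i) (h x) = h (part M I S i x)"
proof -
  interpret M: direct_sum M I S by fact
  interpret N: direct_sum N J T by fact
  interpret h: abelian_group_hom M N h by fact
  from i have \<sigma>i: "\<sigma> i \<in> J" using \<sigma> by auto
  from x show ?thesis
  proof (induction rule: M.homogeneous_induct)
    case zero
    show ?case using i \<sigma>i by (simp add: M.part_zero N.part_zero)
  next
    case (add x y)
    then show ?case using i \<sigma>i by (simp add: M.part_add N.part_add M.part_closed)
  next
    case (homogeneous j x)
    show ?case
    proof (cases "i = j")
      case True
      then show ?thesis using homogeneous h \<sigma>i by (simp add: M.part_same N.part_same)
    next
      case False
      then have "\<sigma> i \<noteq> \<sigma> j" using \<sigma> i homogeneous by (auto dest: inj_onD)
      then have "part N J T (\<sigma> i) (h x) = \<zero>\<^bsub>N\<^esub>"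
        using homogeneous h \<sigma>i \<sigma> by (intro N.part_other[where j = "\<sigma> j"]) auto
      then show ?thesis using False homogeneous i by (simp add: M.part_other[where j = j])
    qed
  qed
qed

text \<open>Uniqueness holds because \<open>p j\<close>, applied to an arbitrary decomposition,
  returns its coefficient \<open>c j\<close>. This is how new modules receive a grading from
  projections that are already known.\<close>

lemma direct_sumI:
  assumes "abelian_group M" "\<And>i. i \<in> I \<Longrightarrow> additive_subgroup (S i) M"
    and hom: "\<And>i. i \<in> I \<Longrightarrow> abelian_group_hom M M (p i)"
    and p_in: "\<And>i x. \<lbrakk>i \<in> I; x \<in> carrier M\<rbrakk> \<Longrightarrow> p i x \<in> S i"
    and same: "\<And>i x. \<lbrakk>i \<in> I; x \<in> S i\<rbrakk> \<Longrightarrow> p i x = x"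
    and other: "\<And>i j x. \<lbrakk>i \<in> I; j \<in> I; i \<noteq> j; x \<in> S j\<rbrakk> \<Longrightarrow> p i x = \<zero>\<^bsub>M\<^esub>"
    and fin: "\<And>x. x \<in> carrier M \<Longrightarrow> finite {i\<in>I. p i x \<noteq> \<zero>\<^bsub>M\<^esub>}"
    and sum: "\<And>x. x \<in> carrier M \<Longrightarrow> x = (\<Oplus>\<^bsub>M\<^esub>i\<in>{i\<in>I. p i x \<noteq> \<zero>\<^bsub>M\<^esub>}. p i x)"
  shows "direct_sum M I S"
proof -
  interpret M: abelian_group M by fact
  have S: "x \<in> carrier M" if "i \<in> I" "x \<in> S i" for i x
    using assms(2) that additive_subgroup.a_Hcarr by metis
  have "\<exists>!c. c \<in> (\<Pi>\<^sub>E i\<in>I. S i) \<and> finite {i\<in>I. c i \<noteq> \<zero>\<^bsub>M\<^esub>} \<and>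
       x = (\<Oplus>\<^bsub>M\<^esub>i\<in>{i\<in>I. c i \<noteq> \<zero>\<^bsub>M\<^esub>}. c i)" if x: "x \<in> carrier M" for x
  proof (rule ex1I[where a = "\<lambda>i\<in>I. p i x"], intro conjI)
    have eq: "{i \<in> I. (\<lambda>i\<in>I. p i x) i \<noteq> \<zero>\<^bsub>M\<^esub>} = {i \<in> I. p i x \<noteq> \<zero>\<^bsub>M\<^esub>}" by auto
    show "finite {i \<in> I. (\<lambda>i\<in>I. p i x) i \<noteq> \<zero>\<^bsub>M\<^esub>}" unfolding eq using fin[OF x] .
    show "x = (\<Oplus>\<^bsub>M\<^esub>i\<in>{i \<in> I. (\<lambda>i\<in>I. p i x) i \<noteq> \<zero>\<^bsub>M\<^esub>}. (\<lambda>i\<in>I. p i x) i)"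
      unfolding eq by (subst sum[OF x], rule M.finsum_cong') (use p_in x S in auto)
    show "(\<lambda>i\<in>I. p i x) \<in> (\<Pi>\<^sub>E i\<in>I. S i)" using p_in x by auto
  next
    fix c assume c: "c \<in> (\<Pi>\<^sub>E i\<in>I. S i) \<and> finite {i\<in>I. c i \<noteq> \<zero>\<^bsub>M\<^esub>} \<and>
       x = (\<Oplus>\<^bsub>M\<^esub>i\<in>{i\<in>I. c i \<noteq> \<zero>\<^bsub>M\<^esub>}. c i)"
    let ?J = "{i\<in>I. c i \<noteq> \<zero>\<^bsub>M\<^esub>}"
    have cS: "c i \<in> S i" if "i \<in> I" for i using c that by auto
    show "c = (\<lambda>i\<in>I. p i x)"
    proof
      fix j
      show "c j = (\<lambda>i\<in>I. p i x) j"
      proof (cases "j \<in> I")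
        case True
        interpret p: abelian_group_hom M M "p j" using hom True .
        have "p j x = p j (\<Oplus>\<^bsub>M\<^esub>i\<in>?J. c i)" using c by simp
        also have "\<dots> = (\<Oplus>\<^bsub>M\<^esub>i\<in>?J. p j (c i))"
          using cS S by (intro p.hom_finsum) auto
        also have "\<dots> = c j"
        \<comment> \<open>The sum runs over the nonzero coefficients only, so \<open>j\<close> is
          outside its index set when \<open>c j\<close> vanishes.\<close>
        proof (cases "c j = \<zero>\<^bsub>M\<^esub>")
          case j0: True
          have "(\<Oplus>\<^bsub>M\<^esub>i\<in>?J. p j (c i)) = \<zero>\<^bsub>M\<^esub>"
            using True j0 other cS by (intro M.add.finprod_one_eqI) blast
          then show ?thesis using j0 by simp
        next
          case False
          have "(\<Oplus>\<^bsub>M\<^esub>i\<in>?J. p j (c i)) = p j (c j)"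
            using True False c other cS S by (intro M.finsum_only) auto
          then show ?thesis using True same cS by simp
        qed
        finally show ?thesis using True by simp
      next
        case False
        then show ?thesis using c by (auto simp: PiE_def extensional_def)
      qed
    qed
  qed
  then show ?thesis
    using assms(1,2) by (auto simp: direct_sum_def direct_sum_axioms_def internal_direct_sum_def)
qed

section \<open>Modules over strongly graded rings\<close>

lemma abelian_group_homI':
  assumes "abelian_group M" "abelian_group N" "h \<in> carrier M \<rightarrow> carrier N"
    "\<And>x y. \<lbrakk>x \<in> carrier M; y \<in> carrier M\<rbrakk> \<Longrightarrow> h (x \<oplus>\<^bsub>M\<^esub> y) = h x \<oplus>\<^bsub>N\<^esub> h y"
  shows "abelian_group_hom M N h"
  by (rule abelian_group_homI) (use assms assms(1,2)[THEN abelian_group.a_group] in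
      \<open>auto simp: group_hom_def group_hom_axioms_def hom_def\<close>)

text \<open>This is \<open>hom_finsum\<close> for the inclusion map. It moves sums between a
  submodule, or the component of degree \<open>e\<close>, and the ambient module.\<close>

lemma finsum_inclusion:
  assumes "abelian_group N" "abelian_group M" "carrier N \<subseteq> carrier M"
    and "\<And>x y. x \<oplus>\<^bsub>N\<^esub> y = x \<oplus>\<^bsub>M\<^esub> y" and "f \<in> I \<rightarrow> carrier N"
  shows "(\<Oplus>\<^bsub>N\<^esub>i\<in>I. f i) = (\<Oplus>\<^bsub>M\<^esub>i\<in>I. f i)"
proof -
  interpret abelian_group_hom N M "\<lambda>x. x"
    using assms by (intro abelian_group_homI') auto
  show ?thesis by (rule hom_finsum) fact
qed

context left_module
begin

lemma smult_hom: "a \<in> carrier R \<Longrightarrow> abelian_group_hom M M ((\<odot>\<^bsub>M\<^esub>) a)"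
  by (rule abelian_group_homI') (auto simp: M.abelian_group_axioms smult_r_distr)

lemma smult_hom': "x \<in> carrier M \<Longrightarrow> abelian_group_hom R M (\<lambda>a. a \<odot>\<^bsub>M\<^esub> x)"
  by (rule abelian_group_homI') (auto simp: M.abelian_group_axioms R.abelian_group_axioms smult_l_distr)

lemma smult_zero [simp]: "a \<in> carrier R \<Longrightarrow> a \<odot>\<^bsub>M\<^esub> \<zero>\<^bsub>M\<^esub> = \<zero>\<^bsub>M\<^esub>"
  using abelian_group_hom.hom_zero[OF smult_hom] .

lemma zero_smult [simp]: "x \<in> carrier M \<Longrightarrow> \<zero> \<odot>\<^bsub>M\<^esub> x = \<zero>\<^bsub>M\<^esub>"
  using abelian_group_hom.hom_zero[OF smult_hom'] .

lemmas smult_finsum = abelian_group_hom.hom_finsum[OF smult_hom]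

end

text \<open>Serves to pass between records that differ only in multiplication, unit or additional
  fields such as a grading.\<close>

lemma left_module_transfer:
  assumes "left_module R M" "carrier N = carrier M" "\<zero>\<^bsub>N\<^esub> = \<zero>\<^bsub>M\<^esub>"
    and "\<And>x y. x \<oplus>\<^bsub>N\<^esub> y = x \<oplus>\<^bsub>M\<^esub> y" "\<And>a x. a \<odot>\<^bsub>N\<^esub> x = a \<odot>\<^bsub>M\<^esub> x"
  shows "left_module R N"
proof -
  interpret M: left_module R M by fact
  have "abelian_group N"
  proof (rule abelian_groupI)
    fix x assume "x \<in> carrier N"
    then show "\<exists>y\<in>carrier N. y \<oplus>\<^bsub>N\<^esub> x = \<zero>\<^bsub>N\<^esub>"
      using M.M.l_neg by (auto simp: assms)
  qed (simp_all add: assms M.M.a_ac)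
  then show ?thesis
    using M.left_module_axioms by (simp add: left_module_def left_module_axioms_def assms)
qed

lemma left_module_homD:
  assumes "f \<in> left_module_hom R M N"
  shows "x \<in> carrier M \<Longrightarrow> f x \<in> carrier N"
    and "\<lbrakk>x \<in> carrier M; y \<in> carrier M\<rbrakk> \<Longrightarrow> f (x \<oplus>\<^bsub>M\<^esub> y) = f x \<oplus>\<^bsub>N\<^esub> f y"
    and "\<lbrakk>a \<in> carrier R; x \<in> carrier M\<rbrakk> \<Longrightarrow> f (a \<odot>\<^bsub>M\<^esub> x) = a \<odot>\<^bsub>N\<^esub> f x"
  using assms by (auto simp: left_module_hom_def)

lemma left_module_hom_additive:
  assumes "left_module R M" "left_module R N" "f \<in> left_module_hom R M N"
  shows "abelian_group_hom M N f"
  using assms by (intro abelian_group_homI') (auto simp: left_module_hom_def left_module_def)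

locale left_submodule = left_module +
  fixes L
  assumes subset: "L \<subseteq> carrier M"
    and zero_in: "\<zero>\<^bsub>M\<^esub> \<in> L"
    and add_in: "\<lbrakk>x \<in> L; y \<in> L\<rbrakk> \<Longrightarrow> x \<oplus>\<^bsub>M\<^esub> y \<in> L"
    and smult_in: "\<lbrakk>a \<in> carrier R; x \<in> L\<rbrakk> \<Longrightarrow> a \<odot>\<^bsub>M\<^esub> x \<in> L"

lemma (in left_module) submodule_carrier: "left_submodule R M (carrier M)"
  by unfold_locales auto

lemma (in left_module) submodule_zero: "left_submodule R M {\<zero>\<^bsub>M\<^esub>}"
  by unfold_locales auto

lemma submodule_kernel:
  assumes "left_module R M" "left_module R N" "f \<in> left_module_hom R M N"
  shows "left_submodule R M {x \<in> carrier M. f x = \<zero>\<^bsub>N\<^esub>}"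
proof -
  interpret M: left_module R M by fact
  interpret N: left_module R N by fact
  interpret f: abelian_group_hom M N f by (rule left_module_hom_additive[OF assms])
  show ?thesis
    by unfold_locales (auto simp: left_module_homD(3)[OF assms(3)])
qed

lemma submodule_image:
  assumes "left_module R M" "left_module R N" "f \<in> left_module_hom R M N"
  shows "left_submodule R N (f ` carrier M)"
proof -
  interpret M: left_module R M by fact
  interpret N: left_module R N by fact
  interpret f: abelian_group_hom M N f by (rule left_module_hom_additive[OF assms])
  show ?thesis
  proof unfold_locales
    show "\<zero>\<^bsub>N\<^esub> \<in> f ` carrier M" using f.hom_zero by (metis M.zero_closed image_eqI)
    show "a \<odot>\<^bsub>N\<^esub> y \<in> f ` carrier M" if "a \<in> carrier R" "y \<in> f ` carrier M" for a y
      using that left_module_homD(3)[OF assms(3), symmetric] by auto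
    show "x \<oplus>\<^bsub>N\<^esub> y \<in> f ` carrier M" if "x \<in> f ` carrier M" "y \<in> f ` carrier M" for x y
      using that by (auto simp flip: f.hom_add)
  qed auto
qed

text \<open>The result is a plain \<open>module\<close> record without grading, the type to which
  the elements of \<open>fg_projectives\<close> belong. Its multiplicative fields carry no meaning
  and are copied to fill the record.\<close>

definition identity_part ::
  "('g, 'x) monoid_scheme \<Rightarrow> ('g, 'r, 'm) graded_module \<Rightarrow> ('r, 'm) module"
  where "identity_part G M = \<lparr>carrier = component M \<one>\<^bsub>G\<^esub>, monoid.mult = monoid.mult M,
    one = \<one>\<^bsub>M\<^esub>, ring.zero = \<zero>\<^bsub>M\<^esub>, ring.add = add M, smult = smult M\<rparr>"

lemma identity_part_simps [simp]:
  "carrier (identity_part G M) = component M \<one>\<^bsub>G\<^esub>"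
  "\<zero>\<^bsub>identity_part G M\<^esub> = \<zero>\<^bsub>M\<^esub>"
  "x \<oplus>\<^bsub>identity_part G M\<^esub> y = x \<oplus>\<^bsub>M\<^esub> y"
  "a \<odot>\<^bsub>identity_part G M\<^esub> x = a \<odot>\<^bsub>M\<^esub> x"
  by (simp_all add: identity_part_def)

lemma identity_component_simps [simp]:
  "carrier (identity_component G R A) = A \<one>\<^bsub>G\<^esub>"
  "\<zero>\<^bsub>identity_component G R A\<^esub> = \<zero>\<^bsub>R\<^esub>"
  "\<one>\<^bsub>identity_component G R A\<^esub> = \<one>\<^bsub>R\<^esub>"
  "x \<oplus>\<^bsub>identity_component G R A\<^esub> y = x \<oplus>\<^bsub>R\<^esub> y"
  "x \<otimes>\<^bsub>identity_component G R A\<^esub> y = x \<otimes>\<^bsub>R\<^esub> y"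
  by (simp_all add: identity_component_def)

section \<open>Strongly graded rings and graded modules over them\<close>

locale strongly_graded_ring = grp: group G + ring R + grd: direct_sum R "carrier G" A
  for G :: "('g, 'x) monoid_scheme" and R :: "('r, 'y) ring_scheme" (structure) and A +
  assumes mult_in: "\<lbrakk>\<gamma> \<in> carrier G; \<delta> \<in> carrier G; a \<in> A \<gamma>; b \<in> A \<delta>\<rbrakk> \<Longrightarrow> a \<otimes> b \<in> A (\<gamma> \<otimes>\<^bsub>G\<^esub> \<delta>)"
    and strong: "\<lbrakk>\<gamma> \<in> carrier G; \<delta> \<in> carrier G\<rbrakk> \<Longrightarrow> additive_prod R (A \<gamma>) (A \<delta>) = A (\<gamma> \<otimes>\<^bsub>G\<^esub> \<delta>)"
begin

abbreviation "B \<equiv> identity_component G R A"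

text \<open>Left multiplication by \<open>a\<close> is additive and translates degrees by
  \<open>\<delta>\<close>, which is injective on the group.\<close>

lemma part_mult_left:
  assumes "\<gamma> \<in> carrier G" "\<delta> \<in> carrier G" "a \<in> A \<delta>" "x \<in> carrier R"
  shows "grd.pr (\<delta> \<otimes>\<^bsub>G\<^esub> \<gamma>) (a \<otimes> x) = a \<otimes> grd.pr \<gamma> x"
  by (rule part_image[where \<sigma> = "\<lambda>\<gamma>. \<delta> \<otimes>\<^bsub>G\<^esub> \<gamma>" and h = "\<lambda>x. a \<otimes> x"])
    (use assms grd.summand_closed in \<open>auto simp: grd.direct_sum_axioms r_distr abelian_group_axioms mult_in
      intro!: abelian_group_homI' inj_onI\<close>)

text \<open>The part of \<open>\<one>\<close> of degree \<open>e\<close> is a right identity: if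
  \<open>x\<close> has degree \<open>\<delta>\<close>, then the part of
  \<open>x = x \<otimes> \<one>\<close> of degree \<open>\<delta>\<close> involves only this part of
  \<open>\<one>\<close>. A right identity equals \<open>\<one>\<close>.\<close>

lemma one_in: "\<one> \<in> A \<one>\<^bsub>G\<^esub>"
proof -
  let ?e = "grd.pr \<one>\<^bsub>G\<^esub> \<one>"
  have e: "?e \<in> carrier R" by (simp add: grd.part_closed)
  have "x = x \<otimes> ?e" if "x \<in> carrier R" for x
    using that
  proof (induction rule: grd.homogeneous_induct)
    case (homogeneous \<delta> x)
    then show ?case
      using part_mult_left[of "\<one>\<^bsub>G\<^esub>" \<delta> x \<one>] grd.part_same[of \<delta> x] grd.summand_closed by simp
  qed (use e in \<open>auto simp: l_distr\<close>)
  from this[of \<one>] have "\<one> = ?e" using e by simp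
  moreover have "?e \<in> A \<one>\<^bsub>G\<^esub>" by (simp add: grd.part_in)
  ultimately show ?thesis by simp
qed

lemma subring_e: "subring (A \<one>\<^bsub>G\<^esub>) R"
proof (rule subringI)
  interpret e: additive_subgroup "A \<one>\<^bsub>G\<^esub>" R by (simp add: grd.summand_subgroup)
  show "\<ominus> h \<in> A \<one>\<^bsub>G\<^esub>" if "h \<in> A \<one>\<^bsub>G\<^esub>" for h using that e.a_inv_closed by blast
qed (use grd.summand_closed one_in grd.summand_add mult_in[of "\<one>\<^bsub>G\<^esub>" "\<one>\<^bsub>G\<^esub>"] in auto)

lemma ring_e: "ring B"
  unfolding identity_component_def by (rule subring_is_ring[OF subring_e])

end

locale strongly_graded_module = strongly_graded_ring G R A + lm: left_module R M +
    gm: direct_sum M "carrier G" "component M"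
  for G :: "('g, 'x) monoid_scheme" and R :: "('r, 'y) ring_scheme" (structure) and A
    and M :: "('g, 'r, 'm) graded_module" +
  assumes smult_component: "\<lbrakk>\<gamma> \<in> carrier G; \<delta> \<in> carrier G; a \<in> A \<gamma>; x \<in> component M \<delta>\<rbrakk> \<Longrightarrow>
    a \<odot>\<^bsub>M\<^esub> x \<in> component M (\<gamma> \<otimes>\<^bsub>G\<^esub> \<delta>)"
begin

text \<open>For \<open>x\<close> of degree \<open>e\<close> the map from \<open>R\<close> to
  \<open>M\<close> that sends \<open>a\<close> to \<open>a x\<close> preserves degrees.\<close>

lemma part_smult_right:
  assumes "\<gamma> \<in> carrier G" "a \<in> carrier R" "x \<in> component M \<one>\<^bsub>G\<^esub>"
  shows "gm.pr \<gamma> (a \<odot>\<^bsub>M\<^esub> x) = grd.pr \<gamma> a \<odot>\<^bsub>M\<^esub> x"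
  using part_image[where \<sigma> = "\<lambda>\<gamma>. \<gamma>" and h = "\<lambda>a. a \<odot>\<^bsub>M\<^esub> x", OF grd.direct_sum_axioms gm.direct_sum_axioms]
    assms gm.summand_closed[OF _ assms(3)] smult_component[of _ "\<one>\<^bsub>G\<^esub>" _ x] lm.smult_hom'
  by auto

text \<open>The only use of strong gradedness: \<open>\<one>\<close> is a sum of products of elements of degrees \<open>\<gamma>\<close> and
  the inverse of \<open>\<gamma>\<close>.\<close>

lemma homogeneous_in_submodule:
  assumes L: "left_submodule R M L" and \<gamma>: "\<gamma> \<in> carrier G" and x: "x \<in> component M \<gamma>"
    and v: "\<And>v. v \<in> A (inv\<^bsub>G\<^esub> \<gamma>) \<Longrightarrow> v \<odot>\<^bsub>M\<^esub> x \<in> L"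
  shows "x \<in> L"
proof -
  interpret L: left_submodule R M L by fact
  have xM: "x \<in> carrier M" using gm.summand_closed \<gamma> x by blast
  have "\<one> \<in> additive_prod R (A \<gamma>) (A (inv\<^bsub>G\<^esub> \<gamma>))"
    using strong[of \<gamma> "inv\<^bsub>G\<^esub> \<gamma>"] \<gamma> one_in by simp
  \<comment> \<open>The \<open>r\<close> with \<open>r x \<in> L\<close> are closed under sums and
    negatives, and contain every product \<open>b c\<close> because \<open>c x \<in> L\<close> by
    \<open>v\<close>.\<close>
  moreover have "r \<in> carrier R \<and> r \<odot>\<^bsub>M\<^esub> x \<in> L" if "r \<in> additive_prod R (A \<gamma>) (A (inv\<^bsub>G\<^esub> \<gamma>))" for r
    using that unfolding additive_prod_def
  proof (induction rule: generate.induct)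
    case one
    show ?case using xM L.zero_in by simp
  next
    case (incl h)
    then obtain b c where bc: "h = b \<otimes> c" "b \<in> A \<gamma>" "c \<in> A (inv\<^bsub>G\<^esub> \<gamma>)" by blast
    then have "b \<in> carrier R" "c \<in> carrier R" using \<gamma> grd.summand_closed[of \<gamma>] grd.summand_closed[of "inv\<^bsub>G\<^esub> \<gamma>"] by auto
    then show ?case using bc v L.smult_in xM by (simp add: lm.smult_assoc1)
  next
    case (inv h)
    then obtain b c where bc: "h = b \<otimes> c" "b \<in> A \<gamma>" "c \<in> A (inv\<^bsub>G\<^esub> \<gamma>)" by blast
    then have "b \<in> carrier R" "c \<in> carrier R" using \<gamma> grd.summand_closed[of \<gamma>] grd.summand_closed[of "inv\<^bsub>G\<^esub> \<gamma>"] by auto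
    moreover from this have "inv\<^bsub>add_monoid R\<^esub> h = (\<ominus> b) \<otimes> c"
      using bc l_minus by (simp add: a_inv_def)
    ultimately show ?case using bc v L.smult_in xM by (simp add: lm.smult_assoc1)
  next
    case (eng g h)
    then show ?case using xM L.add_in by (simp add: lm.smult_l_distr)
  qed
  ultimately show ?thesis using xM by force
qed

text \<open>Every part of \<open>x\<close> lies in \<open>L\<close> by
  \<open>homogeneous_in_submodule\<close>, and \<open>x\<close> is their sum. Since the elements
  \<open>v x\<^sub>\<gamma>\<close> have degree \<open>e\<close>, this acts as an induction
  principle: a property stable under the module operations holds everywhere if it holds on the
  component of degree \<open>e\<close>.\<close>

lemma in_submodule:
  assumes L: "left_submodule R M L" and x: "x \<in> carrier M"
    and v: "\<And>\<gamma> v. \<lbrakk>\<gamma> \<in> carrier G; v \<in> A (inv\<^bsub>G\<^esub> \<gamma>)\<rbrakk> \<Longrightarrow> v \<odot>\<^bsub>M\<^esub> gm.pr \<gamma> x \<in> L"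
  shows "x \<in> L"
proof (rule gm.in_closed_set_if_parts[OF x])
  show "gm.pr \<gamma> x \<in> L" if "\<gamma> \<in> carrier G" for \<gamma>
    using homogeneous_in_submodule[OF L that] v that gm.part_in x by blast
qed (use left_submodule.subset[OF L] left_submodule.zero_in[OF L] left_submodule.add_in[OF L] in auto)

lemma smult_inv_in:
  "\<lbrakk>\<gamma> \<in> carrier G; v \<in> A (inv\<^bsub>G\<^esub> \<gamma>); x \<in> carrier M\<rbrakk> \<Longrightarrow> v \<odot>\<^bsub>M\<^esub> gm.pr \<gamma> x \<in> component M \<one>\<^bsub>G\<^esub>"
  using smult_component[of "inv\<^bsub>G\<^esub> \<gamma>" \<gamma> v] gm.part_in by simp

text \<open>This is \<open>in_submodule\<close> for the zero submodule, applied to the difference of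
  \<open>x\<close> and \<open>y\<close>.\<close>

lemma eq_if_smult_parts_eq:
  assumes "x \<in> carrier M" "y \<in> carrier M"
    and "\<And>\<gamma> v. \<lbrakk>\<gamma> \<in> carrier G; v \<in> A (inv\<^bsub>G\<^esub> \<gamma>)\<rbrakk> \<Longrightarrow> v \<odot>\<^bsub>M\<^esub> gm.pr \<gamma> x = v \<odot>\<^bsub>M\<^esub> gm.pr \<gamma> y"
  shows "x = y"
proof -
  have "x \<ominus>\<^bsub>M\<^esub> y \<in> {\<zero>\<^bsub>M\<^esub>}"
  proof (rule in_submodule[OF lm.submodule_zero])
    fix \<gamma> v assume \<gamma>: "\<gamma> \<in> carrier G" and v: "v \<in> A (inv\<^bsub>G\<^esub> \<gamma>)"
    interpret p: abelian_group_hom M M "gm.pr \<gamma>" using gm.part_hom \<gamma> .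
    have "v \<in> carrier R" using \<gamma> v grd.summand_closed[of "inv\<^bsub>G\<^esub> \<gamma>"] by simp
    then interpret v: abelian_group_hom M M "\<lambda>x. v \<odot>\<^bsub>M\<^esub> x" using lm.smult_hom by simp
    show "v \<odot>\<^bsub>M\<^esub> gm.pr \<gamma> (x \<ominus>\<^bsub>M\<^esub> y) \<in> {\<zero>\<^bsub>M\<^esub>}"
      using assms \<gamma> v by (simp add: a_minus_def gm.part_closed)
        (metis lm.smult_closed gm.part_closed lm.M.r_neg assms(2) \<open>v \<in> carrier R\<close>)
  qed (use assms in simp)
  moreover have "x = (x \<ominus>\<^bsub>M\<^esub> y) \<oplus>\<^bsub>M\<^esub> y"
    using assms by (simp add: a_minus_def lm.M.a_assoc lm.M.l_neg)
  ultimately show ?thesis using assms by simp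
qed

lemma left_module_identity_part: "left_module B (identity_part G M)"
proof -
  interpret C: additive_subgroup "component M \<one>\<^bsub>G\<^esub>" M using gm.summand_subgroup by simp
  have "abelian_group (identity_part G M)"
  proof (rule abelian_groupI)
    fix x assume "x \<in> carrier (identity_part G M)"
    then show "\<exists>y\<in>carrier (identity_part G M). y \<oplus>\<^bsub>identity_part G M\<^esub> x = \<zero>\<^bsub>identity_part G M\<^esub>"
      using C.a_inv_closed[of x] lm.M.l_neg[OF C.a_Hcarr, of x] by auto
  qed (use C.a_Hcarr in \<open>auto simp: lm.M.a_ac\<close>)
  moreover have "a \<in> carrier R" if "a \<in> A \<one>\<^bsub>G\<^esub>" for a
    using grd.summand_closed[OF grp.one_closed that] .
  ultimately show ?thesis
    using ring_e C.a_Hcarr smult_component[of "\<one>\<^bsub>G\<^esub>" "\<one>\<^bsub>G\<^esub>"]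
    by (auto simp: left_module_def left_module_axioms_def
        lm.smult_l_distr lm.smult_r_distr lm.smult_assoc1)
qed

end

lemma (in strongly_graded_ring) strongly_graded_moduleI:
  "is_graded_module G R A M \<Longrightarrow> strongly_graded_module G R A M"
  using strongly_graded_ring_axioms
  by (auto simp: is_graded_module_def strongly_graded_module_def strongly_graded_module_axioms_def
      direct_sum_def direct_sum_axioms_def left_module_def)

lemma (in strongly_graded_module) is_graded_module: "is_graded_module G R A M"
  using lm.left_module_axioms gm.decomposition smult_component by (auto simp: is_graded_module_def)

section \<open>Graded homomorphisms and identity components\<close>

text \<open>The graph of the \<open>R\<close>-linear extension of \<open>f\<close> from \<open>C\<close>, here the identity component of \<open>M\<close>, to
  \<open>M\<close>. It replaces the tensor product: over a strongly graded ring it is total and functional,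
  because \<open>v y\<^sub>\<gamma> = f (v x\<^sub>\<gamma>)\<close> for all its pairs \<open>(x, y)\<close> and all \<open>v\<close> of degree inverse to \<open>\<gamma>\<close>.\<close>

inductive extension_graph ::
  "('r, 'y) ring_scheme \<Rightarrow> ('r, 'm, 'u) module_scheme \<Rightarrow> ('r, 'n, 'v) module_scheme \<Rightarrow>
    'm set \<Rightarrow> ('m \<Rightarrow> 'n) \<Rightarrow> 'm \<Rightarrow> 'n \<Rightarrow> bool"
  for R M N C f where
    smult: "\<lbrakk>a \<in> carrier R; x \<in> C\<rbrakk> \<Longrightarrow> extension_graph R M N C f (a \<odot>\<^bsub>M\<^esub> x) (a \<odot>\<^bsub>N\<^esub> f x)"
  | add: "\<lbrakk>extension_graph R M N C f x y; extension_graph R M N C f x' y'\<rbrakk> \<Longrightarrow>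
      extension_graph R M N C f (x \<oplus>\<^bsub>M\<^esub> x') (y \<oplus>\<^bsub>N\<^esub> y')"

locale strongly_graded_module_pair =
  M: strongly_graded_module G R A M + N: strongly_graded_module G R A N
  for G :: "('g, 'x) monoid_scheme" and R :: "('r, 'y) ring_scheme" (structure) and A
    and M :: "('g, 'r, 'm) graded_module" and N :: "('g, 'r, 'n) graded_module"
begin

lemma graded_hom_left_module_hom: "F \<in> graded_hom G R M N \<Longrightarrow> F \<in> left_module_hom R M N"
  by (simp add: graded_hom_def)

lemma graded_hom_component:
  "\<lbrakk>F \<in> graded_hom G R M N; \<gamma> \<in> carrier G; x \<in> component M \<gamma>\<rbrakk> \<Longrightarrow> F x \<in> component N \<gamma>"
  by (auto simp: graded_hom_def)

lemma graded_hom_part: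
  assumes "F \<in> graded_hom G R M N" "\<gamma> \<in> carrier G" "x \<in> carrier M"
  shows "N.gm.pr \<gamma> (F x) = F (M.gm.pr \<gamma> x)"
  using part_image[where \<sigma> = "\<lambda>\<gamma>. \<gamma>", OF M.gm.direct_sum_axioms N.gm.direct_sum_axioms
      left_module_hom_additive[OF M.lm.left_module_axioms N.lm.left_module_axioms
        graded_hom_left_module_hom[OF assms(1)]]]
    assms graded_hom_component[OF assms(1)] by auto

lemma graded_hom_identity_part:
  assumes "F \<in> graded_hom G R M N"
  shows "F \<in> left_module_hom M.B (identity_part G M) (identity_part G N)"
  using assms graded_hom_component[OF assms M.grp.one_closed]
    M.gm.summand_closed[OF M.grp.one_closed] M.grd.summand_closed[OF M.grp.one_closed]
    left_module_homD(2,3)[OF graded_hom_left_module_hom[OF assms]]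
  by (auto simp: left_module_hom_def)

text \<open>The functor to components of degree \<open>e\<close> is full. The extension must send a
  sum of terms \<open>a x\<close> to the sum of the \<open>a f(x)\<close>; such pairs are collected
  in the relation \<open>T\<close>, which is shown afterwards to be a function.\<close>

lemma graded_hom_extension:
  assumes f: "f \<in> left_module_hom M.B (identity_part G M) (identity_part G N)"
  shows "\<exists>F\<in>graded_hom G R M N. \<forall>x\<in>component M \<one>\<^bsub>G\<^esub>. F x = f x"
proof -
  let ?e = "\<one>\<^bsub>G\<^esub>"
  let ?C = "component M ?e"
  have e: "?e \<in> carrier G" by simp
  note CM = M.gm.summand_closed[OF e] and CN = N.gm.summand_closed[OF e]
  have fC: "f x \<in> component N ?e" if "x \<in> ?C" for x
    using left_module_homD(1)[OF f] that by simp
  have f_add: "f (x \<oplus>\<^bsub>M\<^esub> y) = f x \<oplus>\<^bsub>N\<^esub> f y" if "x \<in> ?C" "y \<in> ?C" for x y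
    using left_module_homD(2)[OF f] that by simp
  have f_smult: "f (a \<odot>\<^bsub>M\<^esub> x) = a \<odot>\<^bsub>N\<^esub> f x" if "a \<in> A ?e" "x \<in> ?C" for a x
    using left_module_homD(3)[OF f] that by simp
  interpret f: abelian_group_hom "identity_part G M" "identity_part G N" f
    by (rule left_module_hom_additive[OF M.left_module_identity_part N.left_module_identity_part f])
  have f_zero: "f \<zero>\<^bsub>M\<^esub> = \<zero>\<^bsub>N\<^esub>" using f.hom_zero by simp
  define T where "T = extension_graph R M N ?C f"
  have T_closed: "x \<in> carrier M" "y \<in> carrier N" if "T x y" for x y
    using that unfolding T_def by (induction rule: extension_graph.induct) (auto simp: CM CN fC)
  have v_closed: "v \<in> carrier R" if "\<gamma> \<in> carrier G" "v \<in> A (inv\<^bsub>G\<^esub> \<gamma>)" for \<gamma> v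
    using M.grd.summand_closed[of "inv\<^bsub>G\<^esub> \<gamma>"] that by simp
  \<comment> \<open>On a generating pair, \<open>v\<close> times the part of \<open>a x\<close> of
    degree \<open>\<gamma>\<close> is \<open>(v a\<^sub>\<gamma>) x\<close> with
    \<open>v a\<^sub>\<gamma>\<close> in \<open>R\<^sub>e\<close>, and \<open>f\<close> is linear
    over \<open>R\<^sub>e\<close>.\<close>
  have T_parts: "f (v \<odot>\<^bsub>M\<^esub> M.gm.pr \<gamma> x) = v \<odot>\<^bsub>N\<^esub> N.gm.pr \<gamma> y"
    if \<gamma>: "\<gamma> \<in> carrier G" and v: "v \<in> A (inv\<^bsub>G\<^esub> \<gamma>)" and "T x y" for \<gamma> v x y
    using \<open>T x y\<close> unfolding T_def
  proof (induction rule: extension_graph.induct)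
    case (smult a x)
    have pa: "M.grd.pr \<gamma> a \<in> A \<gamma>" "M.grd.pr \<gamma> a \<in> carrier R"
      using \<gamma> smult by (auto simp: M.grd.part_in M.grd.part_closed)
    then have va: "v \<otimes> M.grd.pr \<gamma> a \<in> A ?e"
      using M.mult_in[of "inv\<^bsub>G\<^esub> \<gamma>" \<gamma>] \<gamma> v by simp
    have "f (v \<odot>\<^bsub>M\<^esub> M.gm.pr \<gamma> (a \<odot>\<^bsub>M\<^esub> x)) = f ((v \<otimes> M.grd.pr \<gamma> a) \<odot>\<^bsub>M\<^esub> x)"
      using smult \<gamma> v_closed[OF \<gamma> v] pa CM by (simp add: M.part_smult_right M.lm.smult_assoc1)
    also have "\<dots> = v \<odot>\<^bsub>N\<^esub> N.gm.pr \<gamma> (a \<odot>\<^bsub>N\<^esub> f x)"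
      using smult \<gamma> v_closed[OF \<gamma> v] pa va CN fC f_smult by (simp add: N.part_smult_right N.lm.smult_assoc1)
    finally show ?case .
  next
    case (add x y x' y')
    then have "x \<in> carrier M" "x' \<in> carrier M" "y \<in> carrier N" "y' \<in> carrier N"
      using T_closed by (auto simp: T_def)
    then show ?case
      using add \<gamma> v v_closed[OF \<gamma> v]
      by (simp add: M.gm.part_add N.gm.part_add M.gm.part_closed N.gm.part_closed
          M.lm.smult_r_distr N.lm.smult_r_distr f_add M.smult_inv_in)
  qed
  have T_add: "T (x \<oplus>\<^bsub>M\<^esub> x') (y \<oplus>\<^bsub>N\<^esub> y')" if "T x y" "T x' y'" for x y x' y'
    using that extension_graph.add unfolding T_def by metis
  have T_smult: "T (b \<odot>\<^bsub>M\<^esub> x) (b \<odot>\<^bsub>N\<^esub> y)" if "b \<in> carrier R" "T x y" for b x y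
    using that(2) unfolding T_def
  proof (induction rule: extension_graph.induct)
    case (smult a x)
    then show ?case
      using extension_graph.smult[of "b \<otimes> a" R x ?C M N f] that(1) CM[of x] CN[OF fC[of x]]
      by (simp add: M.lm.smult_assoc1 N.lm.smult_assoc1)
  next
    case (add x y x' y')
    then show ?case
      using extension_graph.add[OF add.IH] that(1) T_closed[unfolded T_def]
      by (simp add: M.lm.smult_r_distr N.lm.smult_r_distr)
  qed
  have T_extends: "T x (f x)" if "x \<in> ?C" for x
    using extension_graph.smult[of \<one> R x ?C M N f] that CM CN fC unfolding T_def by simp
  \<comment> \<open>The domain of \<open>T\<close> is a submodule that contains the component of
    degree \<open>e\<close>.\<close>
  have T_total: "x \<in> {x. \<exists>y. T x y}" if "x \<in> carrier M" for x
  proof (rule M.in_submodule[OF _ that])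
    show "left_submodule R M {x. \<exists>y. T x y}"
    proof unfold_locales
      show "\<zero>\<^bsub>M\<^esub> \<in> {x. \<exists>y. T x y}" using T_extends M.gm.summand_zero[OF e] by blast
    qed (use T_closed T_add T_smult in blast)+
    show "v \<odot>\<^bsub>M\<^esub> M.gm.pr \<gamma> x \<in> {x. \<exists>y. T x y}" if "\<gamma> \<in> carrier G" "v \<in> A (inv\<^bsub>G\<^esub> \<gamma>)" for \<gamma> v
      using T_extends M.smult_inv_in that \<open>x \<in> carrier M\<close> by blast
  qed
  \<comment> \<open>By \<open>T_parts\<close> all elements \<open>v y\<^sub>\<gamma>\<close> are
    determined by \<open>x\<close>, and they determine \<open>y\<close>.\<close>
  have T_fun: "y = y'" if "T x y" "T x y'" for x y y'
    by (rule N.eq_if_smult_parts_eq) (use that T_closed T_parts in \<open>metis+\<close>)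
  define F where "F x = (THE y. T x y)" for x
  have TF: "T x (F x)" if "x \<in> carrier M" for x
  proof -
    obtain y where y: "T x y" using T_total \<open>x \<in> carrier M\<close> by blast
    show ?thesis unfolding F_def by (rule theI[where a = y]) (use y T_fun in blast)+
  qed
  have F_eq: "F x = y" if "T x y" for x y
    using TF T_closed T_fun that by blast
  have "F \<in> left_module_hom R M N"
    using T_closed(2)[OF TF] F_eq[OF T_add[OF TF TF]] F_eq[OF T_smult[OF _ TF]]
    by (auto simp: left_module_hom_def)
  moreover have "F x \<in> component N \<gamma>" if \<gamma>: "\<gamma> \<in> carrier G" and x: "x \<in> component M \<gamma>" for \<gamma> x
  proof -
    have xM: "x \<in> carrier M" using \<gamma> x M.gm.summand_closed by blast
    have Fx: "F x \<in> carrier N" using TF[OF xM] T_closed by blast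
    \<comment> \<open>In a degree \<open>\<delta>\<close> other than \<open>\<gamma>\<close> the
      part of \<open>x\<close> is zero, so \<open>T_parts\<close> equates \<open>v\<close> times the
      part of \<open>F x\<close> with \<open>f 0 = 0\<close>.\<close>
    have "F x = N.gm.pr \<gamma> (F x)"
    proof (rule N.eq_if_smult_parts_eq)
      fix \<delta> v assume \<delta>: "\<delta> \<in> carrier G" and v: "v \<in> A (inv\<^bsub>G\<^esub> \<delta>)"
      show "v \<odot>\<^bsub>N\<^esub> N.gm.pr \<delta> (F x) = v \<odot>\<^bsub>N\<^esub> N.gm.pr \<delta> (N.gm.pr \<gamma> (F x))"
      proof (cases "\<delta> = \<gamma>")
        case True
        then show ?thesis using \<gamma> Fx by (simp add: N.gm.part_same[OF _ N.gm.part_in])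
      next
        case False
        have "v \<odot>\<^bsub>N\<^esub> N.gm.pr \<delta> (F x) = f (v \<odot>\<^bsub>M\<^esub> M.gm.pr \<delta> x)"
          using T_parts[OF \<delta> v TF[OF xM]] by simp
        then show ?thesis
          using False \<delta> \<gamma> x Fx v_closed[OF \<delta> v] f_zero
          by (simp add: M.gm.part_other[of \<delta> \<gamma>] N.gm.part_other[OF _ _ _ N.gm.part_in, of \<delta> \<gamma>])
      qed
    qed (use Fx \<gamma> N.gm.part_closed in auto)
    then show ?thesis using N.gm.part_in[OF \<gamma> Fx] by simp
  qed
  ultimately have "F \<in> graded_hom G R M N" by (auto simp: graded_hom_def)
  then show ?thesis using F_eq T_extends by blast
qed

end

section \<open>Graded submodules and their components of degree \<open>e\<close>\<close>

locale graded_submodule = strongly_graded_module G R A M + left_submodule R M L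
  for G :: "('g, 'x) monoid_scheme" and R :: "('r, 'y) ring_scheme" (structure) and A
    and M :: "('g, 'r, 'm) graded_module" and L +
  assumes parts_in: "\<lbrakk>\<gamma> \<in> carrier G; x \<in> L\<rbrakk> \<Longrightarrow> gm.pr \<gamma> x \<in> L"

text \<open>For \<open>x \<in> K\<close> every \<open>v x\<^sub>\<gamma>\<close> is again in
  \<open>K\<close>, since \<open>K\<close> is graded, and has degree \<open>e\<close>; hence it lies
  in \<open>L\<close>, and \<open>in_submodule\<close> gives \<open>x \<in> L\<close>.\<close>

lemma graded_submodule_subset_iff:
  assumes "graded_submodule G R A M K" "graded_submodule G R A M L"
  shows "K \<subseteq> L \<longleftrightarrow> K \<inter> component M \<one>\<^bsub>G\<^esub> \<subseteq> L"
proof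
  interpret K: graded_submodule G R A M K by fact
  interpret L: graded_submodule G R A M L by fact
  assume sub: "K \<inter> component M \<one>\<^bsub>G\<^esub> \<subseteq> L"
  show "K \<subseteq> L"
  proof
    fix x assume x: "x \<in> K"
    then have xM: "x \<in> carrier M" using K.subset by blast
    show "x \<in> L"
    proof (rule K.in_submodule[OF L.left_submodule_axioms xM])
      fix \<gamma> v assume "\<gamma> \<in> carrier G" "v \<in> A (inv\<^bsub>G\<^esub> \<gamma>)"
      then show "v \<odot>\<^bsub>M\<^esub> K.gm.pr \<gamma> x \<in> L"
        using x xM K.smult_in K.parts_in K.grd.summand_closed[of "inv\<^bsub>G\<^esub> \<gamma>" v] K.smult_inv_in sub by auto
    qed
  qed
qed blast

lemma graded_submodule_eq_iff:
  assumes "graded_submodule G R A M K" "graded_submodule G R A M L"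
  shows "K = L \<longleftrightarrow> K \<inter> component M \<one>\<^bsub>G\<^esub> = L \<inter> component M \<one>\<^bsub>G\<^esub>"
  using graded_submodule_subset_iff[OF assms] graded_submodule_subset_iff[OF assms(2,1)] by blast

context strongly_graded_module
begin

lemma graded_submodule_carrier: "graded_submodule G R A M (carrier M)"
  using strongly_graded_module_axioms lm.submodule_carrier gm.part_closed
  by (simp add: graded_submodule_def graded_submodule_axioms_def)

lemma graded_submodule_zero: "graded_submodule G R A M {\<zero>\<^bsub>M\<^esub>}"
  using strongly_graded_module_axioms lm.submodule_zero gm.part_zero
  by (simp add: graded_submodule_def graded_submodule_axioms_def)

end

context strongly_graded_module_pair
begin

lemma graded_submodule_kernel:
  assumes "F \<in> graded_hom G R M N"
  shows "graded_submodule G R A M {x \<in> carrier M. F x = \<zero>\<^bsub>N\<^esub>}"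
  using M.strongly_graded_module_axioms M.gm.part_closed graded_hom_part[OF assms, symmetric] N.gm.part_zero
    submodule_kernel[OF M.lm.left_module_axioms N.lm.left_module_axioms
      graded_hom_left_module_hom[OF assms]]
  by (simp add: graded_submodule_def graded_submodule_axioms_def)

lemma graded_submodule_image:
  assumes "F \<in> graded_hom G R M N"
  shows "graded_submodule G R A N (F ` carrier M)"
  using N.strongly_graded_module_axioms M.gm.part_closed graded_hom_part[OF assms]
    submodule_image[OF M.lm.left_module_axioms N.lm.left_module_axioms
      graded_hom_left_module_hom[OF assms]]
  by (auto simp: graded_submodule_def graded_submodule_axioms_def)

text \<open>If \<open>F x\<close> has degree \<open>e\<close>, then it equals its own part of degree
  \<open>e\<close>, which is the image of that of \<open>x\<close>.\<close>

lemma image_identity_part: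
  assumes "F \<in> graded_hom G R M N"
  shows "F ` carrier M \<inter> component N \<one>\<^bsub>G\<^esub> = F ` component M \<one>\<^bsub>G\<^esub>"
proof -
  have e: "\<one>\<^bsub>G\<^esub> \<in> carrier G" by simp
  have "F x \<in> F ` component M \<one>\<^bsub>G\<^esub>" if "x \<in> carrier M" "F x \<in> component N \<one>\<^bsub>G\<^esub>" for x
    using graded_hom_part[OF assms e that(1)] N.gm.part_same[OF e that(2)] M.gm.part_in[OF e that(1)]
    by (metis image_eqI)
  then show ?thesis
    using graded_hom_component[OF assms e] M.gm.summand_closed[OF e] by auto
qed

text \<open>The image of \<open>F\<close> and the whole of \<open>N\<close> are graded submodules,
  so they can be compared in degree \<open>e\<close>.\<close>

lemma surj_iff_identity_part:
  assumes "F \<in> graded_hom G R M N"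
  shows "F ` carrier M = carrier N \<longleftrightarrow> F ` component M \<one>\<^bsub>G\<^esub> = component N \<one>\<^bsub>G\<^esub>"
proof -
  have "carrier N \<inter> component N \<one>\<^bsub>G\<^esub> = component N \<one>\<^bsub>G\<^esub>"
    using N.gm.summand_closed[OF M.grp.one_closed] by blast
  then show ?thesis
    using graded_submodule_eq_iff[OF graded_submodule_image[OF assms] N.graded_submodule_carrier]
    by (simp add: image_identity_part[OF assms])
qed

text \<open>The kernel of \<open>F\<close> and the zero submodule are graded, so they can be
  compared in degree \<open>e\<close>.\<close>

lemma inj_iff_identity_part:
  assumes "F \<in> graded_hom G R M N"
  shows "inj_on F (carrier M) \<longleftrightarrow> inj_on F (component M \<one>\<^bsub>G\<^esub>)"
proof
  assume inj: "inj_on F (component M \<one>\<^bsub>G\<^esub>)"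
  interpret F: abelian_group_hom M N F
    using left_module_hom_additive[OF M.lm.left_module_axioms N.lm.left_module_axioms
        graded_hom_left_module_hom[OF assms]] .
  have z: "\<zero>\<^bsub>M\<^esub> \<in> component M \<one>\<^bsub>G\<^esub>" by (simp add: M.gm.summand_zero)
  have "{x \<in> carrier M. F x = \<zero>\<^bsub>N\<^esub>} \<subseteq> {\<zero>\<^bsub>M\<^esub>}"
    unfolding graded_submodule_subset_iff[OF graded_submodule_kernel[OF assms] M.graded_submodule_zero]
    using F.hom_zero inj_onD[OF inj _ _ z] by auto
  then have *: "x = \<zero>\<^bsub>M\<^esub>" if "x \<in> carrier M" "F x = \<zero>\<^bsub>N\<^esub>" for x
    using that by blast
  show "inj_on F (carrier M)"
  proof (rule inj_onI)
    fix x y assume xy: "x \<in> carrier M" "y \<in> carrier M" "F x = F y"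
    then have "F (x \<ominus>\<^bsub>M\<^esub> y) = \<zero>\<^bsub>N\<^esub>"
      by (simp add: a_minus_def N.lm.M.r_neg)
    then have "x \<ominus>\<^bsub>M\<^esub> y = \<zero>\<^bsub>M\<^esub>" using * xy by simp
    moreover have "x = (x \<ominus>\<^bsub>M\<^esub> y) \<oplus>\<^bsub>M\<^esub> y"
      using xy by (simp add: a_minus_def M.lm.M.a_assoc M.lm.M.l_neg)
    ultimately show "x = y" using xy by simp
  qed
next
  show "inj_on F (carrier M) \<Longrightarrow> inj_on F (component M \<one>\<^bsub>G\<^esub>)"
    using M.gm.summand_closed[OF M.grp.one_closed] by (auto intro: inj_on_subset)
qed

lemma bij_iff_identity_part:
  assumes "F \<in> graded_hom G R M N"
  shows "bij_betw F (carrier M) (carrier N) \<longleftrightarrow> bij_betw F (component M \<one>\<^bsub>G\<^esub>) (component N \<one>\<^bsub>G\<^esub>)"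
  using inj_iff_identity_part[OF assms] surj_iff_identity_part[OF assms] by (simp add: bij_betw_def)

end

section \<open>Isomorphisms and short exact sequences in degree \<open>e\<close>\<close>

context strongly_graded_ring
begin

text \<open>Exactness in the middle is an equality of two graded submodules of \<open>M\<close>, the
  image of \<open>f\<close> and the kernel of \<open>g\<close>; their intersections with the
  component of degree \<open>e\<close> are the image and the kernel of the restricted maps.\<close>

lemma short_exact_iff_identity_part:
  assumes "strongly_graded_module G R A L" "strongly_graded_module G R A M"
    and "strongly_graded_module G R A N" and f: "f \<in> graded_hom G R L M" and g: "g \<in> graded_hom G R M N"
  shows "short_exact L M N f g \<longleftrightarrow>
    short_exact (identity_part G L) (identity_part G M) (identity_part G N) f g"
proof -
  interpret LM: strongly_graded_module_pair G R A L M
    using assms by (simp add: strongly_graded_module_pair_def)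
  interpret MN: strongly_graded_module_pair G R A M N
    using assms by (simp add: strongly_graded_module_pair_def)
  have "{x \<in> carrier M. g x = \<zero>\<^bsub>N\<^esub>} \<inter> component M \<one>\<^bsub>G\<^esub> = {x \<in> component M \<one>\<^bsub>G\<^esub>. g x = \<zero>\<^bsub>N\<^esub>}"
    using LM.N.gm.summand_closed[OF grp.one_closed] by blast
  then show ?thesis
    using graded_submodule_eq_iff[OF LM.graded_submodule_image[OF f] MN.graded_submodule_kernel[OF g]]
      LM.image_identity_part[OF f] LM.inj_iff_identity_part[OF f] MN.surj_iff_identity_part[OF g]
    by (simp add: short_exact_def)
qed

text \<open>Maps are restricted in one direction and extended in the other; the extension of a
  bijection is bijective because bijectivity is decided in degree \<open>e\<close>.\<close>

lemma ex_iso_iff_identity_part: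
  assumes "strongly_graded_module G R A M" "strongly_graded_module G R A N"
  shows "(\<exists>f \<in> graded_hom G R M N. bij_betw f (carrier M) (carrier N)) \<longleftrightarrow>
    (\<exists>f \<in> left_module_hom B (identity_part G M) (identity_part G N).
      bij_betw f (carrier (identity_part G M)) (carrier (identity_part G N)))" (is "?l \<longleftrightarrow> ?r")
proof -
  interpret MN: strongly_graded_module_pair G R A M N
    using assms by (simp add: strongly_graded_module_pair_def)
  show ?thesis
  proof
    show "?l \<Longrightarrow> ?r"
      using MN.graded_hom_identity_part MN.bij_iff_identity_part by auto
    assume ?r
    then obtain f where f: "f \<in> left_module_hom B (identity_part G M) (identity_part G N)"
      "bij_betw f (component M \<one>\<^bsub>G\<^esub>) (component N \<one>\<^bsub>G\<^esub>)" by auto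
    obtain F where F: "F \<in> graded_hom G R M N" "\<And>x. x \<in> component M \<one>\<^bsub>G\<^esub> \<Longrightarrow> F x = f x"
      using MN.graded_hom_extension[OF f(1)] by blast
    have "bij_betw F (component M \<one>\<^bsub>G\<^esub>) (component N \<one>\<^bsub>G\<^esub>)"
      using f(2) F(2) bij_betw_cong[of "component M \<one>\<^bsub>G\<^esub>" F f] by blast
    then show ?l using F(1) MN.bij_iff_identity_part by blast
  qed
qed

lemma ex_short_exact_iff_identity_part:
  assumes L: "strongly_graded_module G R A L" and M: "strongly_graded_module G R A M"
    and N: "strongly_graded_module G R A N"
  shows "(\<exists>f \<in> graded_hom G R L M. \<exists>g \<in> graded_hom G R M N. short_exact L M N f g) \<longleftrightarrow>
    (\<exists>f \<in> left_module_hom B (identity_part G L) (identity_part G M).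
      \<exists>g \<in> left_module_hom B (identity_part G M) (identity_part G N).
        short_exact (identity_part G L) (identity_part G M) (identity_part G N) f g)" (is "?l \<longleftrightarrow> ?r")
proof -
  interpret LM: strongly_graded_module_pair G R A L M
    using assms by (simp add: strongly_graded_module_pair_def)
  interpret MN: strongly_graded_module_pair G R A M N
    using assms by (simp add: strongly_graded_module_pair_def)
  show ?thesis
  proof
    show "?l \<Longrightarrow> ?r"
      using LM.graded_hom_identity_part MN.graded_hom_identity_part
        short_exact_iff_identity_part[OF assms] by blast
    assume ?r
    then obtain f g where f: "f \<in> left_module_hom B (identity_part G L) (identity_part G M)"
      and g: "g \<in> left_module_hom B (identity_part G M) (identity_part G N)"
      and ex: "short_exact (identity_part G L) (identity_part G M) (identity_part G N) f g" by auto
    obtain f' where f': "f' \<in> graded_hom G R L M" "\<And>x. x \<in> component L \<one>\<^bsub>G\<^esub> \<Longrightarrow> f' x = f x"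
      using LM.graded_hom_extension[OF f] by blast
    obtain g' where g': "g' \<in> graded_hom G R M N" "\<And>x. x \<in> component M \<one>\<^bsub>G\<^esub> \<Longrightarrow> g' x = g x"
      using MN.graded_hom_extension[OF g] by blast
    \<comment> \<open>Exactness in degree \<open>e\<close> evaluates the maps only there, where
      \<open>f'\<close> and \<open>g'\<close> agree with \<open>f\<close> and
      \<open>g\<close>.\<close>
    have "short_exact (identity_part G L) (identity_part G M) (identity_part G N) f' g'"
      using ex f'(2) g'(2) unfolding short_exact_def identity_part_simps
      by (simp cong: conj_cong image_cong inj_on_cong)
    then show ?l using f'(1) g'(1) short_exact_iff_identity_part[OF assms] by blast
  qed
qed

end

section \<open>Dual bases\<close>

text \<open>\<open>R\<^sup>n\<close> is encoded by sequences that vanish from \<open>n\<close> on,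
  so that for every \<open>n\<close> the elements have the type \<open>nat \<Rightarrow> 'r\<close>
  of the test modules in \<open>projective_module\<close>.\<close>

definition free_module :: "('r, 'x) ring_scheme \<Rightarrow> nat \<Rightarrow> ('r, nat \<Rightarrow> 'r) module"
  where "free_module R n = \<lparr>carrier = {x. (\<forall>i. x i \<in> carrier R) \<and> (\<forall>i\<ge>n. x i = \<zero>\<^bsub>R\<^esub>)},
    monoid.mult = undefined, one = undefined, ring.zero = (\<lambda>i. \<zero>\<^bsub>R\<^esub>),
    ring.add = (\<lambda>x y i. x i \<oplus>\<^bsub>R\<^esub> y i), smult = (\<lambda>a x i. a \<otimes>\<^bsub>R\<^esub> x i)\<rparr>"

lemma free_module_simps [simp]:
  "x \<in> carrier (free_module R n) \<longleftrightarrow> (\<forall>i. x i \<in> carrier R) \<and> (\<forall>i\<ge>n. x i = \<zero>\<^bsub>R\<^esub>)"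
  "\<zero>\<^bsub>free_module R n\<^esub> = (\<lambda>i. \<zero>\<^bsub>R\<^esub>)"
  "x \<oplus>\<^bsub>free_module R n\<^esub> y = (\<lambda>i. x i \<oplus>\<^bsub>R\<^esub> y i)"
  "a \<odot>\<^bsub>free_module R n\<^esub> x = (\<lambda>i. a \<otimes>\<^bsub>R\<^esub> x i)"
  by (simp_all add: free_module_def)

lemma (in ring) left_module_free_module: "left_module R (free_module R n)"
proof -
  have "abelian_group (free_module R n)"
  proof (rule abelian_groupI)
    fix x assume "x \<in> carrier (free_module R n)"
    then show "\<exists>y\<in>carrier (free_module R n). y \<oplus>\<^bsub>free_module R n\<^esub> x = \<zero>\<^bsub>free_module R n\<^esub>"
      by (intro bexI[where x = "\<lambda>i. \<ominus> x i"]) (auto simp: l_neg)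
  qed (auto simp: a_ac)
  then show ?thesis
    using ring_axioms by (auto simp: left_module_def left_module_axioms_def l_distr r_distr m_assoc)
qed

lemma left_module_hom_comp:
  "\<lbrakk>f \<in> left_module_hom R L M; g \<in> left_module_hom R M N\<rbrakk> \<Longrightarrow> (\<lambda>x. g (f x)) \<in> left_module_hom R L N"
  unfolding left_module_hom_def by (simp add: Pi_iff)

lemma (in left_submodule) finsum_in: "(\<And>i. i \<in> I \<Longrightarrow> f i \<in> L) \<Longrightarrow> (\<Oplus>\<^bsub>M\<^esub>i\<in>I. f i) \<in> L"
  by (rule M.finsum_in_closed_set[OF zero_in add_in subset])

context left_module
begin

lemma linear_combination_hom:
  assumes "m \<in> {..<n} \<rightarrow> carrier M"
  shows "(\<lambda>x. \<Oplus>\<^bsub>M\<^esub>i\<in>{..<n}. x i \<odot>\<^bsub>M\<^esub> m i) \<in> left_module_hom R (free_module R n) M"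
proof -
  have m: "m i \<in> carrier M" if "i < n" for i using assms that by auto
  show ?thesis
    unfolding left_module_hom_def
  proof (safe, goal_cases)
    case (1 x)
    then show ?case using m by (intro M.finsum_closed) auto
  next
    case (2 x y)
    have "(\<Oplus>\<^bsub>M\<^esub>i\<in>{..<n}. (x i \<oplus> y i) \<odot>\<^bsub>M\<^esub> m i) = (\<Oplus>\<^bsub>M\<^esub>i\<in>{..<n}. x i \<odot>\<^bsub>M\<^esub> m i \<oplus>\<^bsub>M\<^esub> y i \<odot>\<^bsub>M\<^esub> m i)"
      using 2 m by (intro M.finsum_cong') (auto simp: smult_l_distr)
    also have "\<dots> = (\<Oplus>\<^bsub>M\<^esub>i\<in>{..<n}. x i \<odot>\<^bsub>M\<^esub> m i) \<oplus>\<^bsub>M\<^esub> (\<Oplus>\<^bsub>M\<^esub>i\<in>{..<n}. y i \<odot>\<^bsub>M\<^esub> m i)"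
      using 2 m by (intro M.finsum_addf) auto
    finally show ?case by simp
  next
    case (3 a x)
    have "(\<Oplus>\<^bsub>M\<^esub>i\<in>{..<n}. (a \<otimes> x i) \<odot>\<^bsub>M\<^esub> m i) = (\<Oplus>\<^bsub>M\<^esub>i\<in>{..<n}. a \<odot>\<^bsub>M\<^esub> (x i \<odot>\<^bsub>M\<^esub> m i))"
      using 3 m by (intro M.finsum_cong') (auto simp: smult_assoc1)
    also have "\<dots> = a \<odot>\<^bsub>M\<^esub> (\<Oplus>\<^bsub>M\<^esub>i\<in>{..<n}. x i \<odot>\<^bsub>M\<^esub> m i)"
      using 3 m by (intro smult_finsum[symmetric]) auto
    finally show ?case by simp
  qed
qed

lemma hom_linear_combination:
  assumes "left_module R N" "f \<in> left_module_hom R M N" "m \<in> I \<rightarrow> carrier M" "c \<in> I \<rightarrow> carrier R"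
  shows "f (\<Oplus>\<^bsub>M\<^esub>i\<in>I. c i \<odot>\<^bsub>M\<^esub> m i) = (\<Oplus>\<^bsub>N\<^esub>i\<in>I. c i \<odot>\<^bsub>N\<^esub> f (m i))"
proof -
  interpret N: left_module R N by fact
  interpret f: abelian_group_hom M N f
    by (rule left_module_hom_additive[OF left_module_axioms assms(1,2)])
  have "f (\<Oplus>\<^bsub>M\<^esub>i\<in>I. c i \<odot>\<^bsub>M\<^esub> m i) = (\<Oplus>\<^bsub>N\<^esub>i\<in>I. f (c i \<odot>\<^bsub>M\<^esub> m i))"
    using assms(3,4) by (intro f.hom_finsum) auto
  also have "\<dots> = (\<Oplus>\<^bsub>N\<^esub>i\<in>I. c i \<odot>\<^bsub>N\<^esub> f (m i))"
    by (rule N.M.finsum_cong') (use assms(3,4) left_module_homD[OF assms(2)] in \<open>auto simp: Pi_iff\<close>)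
  finally show ?thesis .
qed

text \<open>The linear combinations of \<open>S\<close> form the smallest submodule containing
  \<open>S\<close>. In this form, without coefficients, finite generation can be combined with
  \<open>in_submodule\<close>.\<close>

lemma finitely_generated_iff:
  "finitely_generated R M \<longleftrightarrow>
    (\<exists>S. finite S \<and> S \<subseteq> carrier M \<and> (\<forall>L. left_submodule R M L \<and> S \<subseteq> L \<longrightarrow> carrier M \<subseteq> L))"
    (is "_ \<longleftrightarrow> ?r")
proof
  assume "finitely_generated R M"
  then obtain S where S: "finite S" "S \<subseteq> carrier M"
    and gen: "\<And>x. x \<in> carrier M \<Longrightarrow> \<exists>c \<in> S \<rightarrow> carrier R. x = (\<Oplus>\<^bsub>M\<^esub>s\<in>S. c s \<odot>\<^bsub>M\<^esub> s)"
    unfolding finitely_generated_def by blast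
  have "x \<in> L" if L: "left_submodule R M L" "S \<subseteq> L" and x: "x \<in> carrier M" for L x
  proof -
    obtain c where c: "c \<in> S \<rightarrow> carrier R" "x = (\<Oplus>\<^bsub>M\<^esub>s\<in>S. c s \<odot>\<^bsub>M\<^esub> s)" using gen[OF x] by blast
    show ?thesis unfolding c(2)
      by (rule left_submodule.finsum_in[OF L(1)]) (use c(1) L left_submodule.smult_in[OF L(1)] in auto)
  qed
  then show ?r using S by blast
next
  assume ?r
  then obtain S where S: "finite S" "S \<subseteq> carrier M"
    and gen': "\<forall>L. left_submodule R M L \<and> S \<subseteq> L \<longrightarrow> carrier M \<subseteq> L"
    by (elim exE conjE)
  have gen: "carrier M \<subseteq> L" if "left_submodule R M L" "S \<subseteq> L" for L
    using gen' that by simp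
  define lc where "lc c = (\<Oplus>\<^bsub>M\<^esub>s\<in>S. c s \<odot>\<^bsub>M\<^esub> s)" for c
  have "carrier M \<subseteq> lc ` (S \<rightarrow> carrier R)"
  proof (rule gen)
    show "left_submodule R M (lc ` (S \<rightarrow> carrier R))"
    proof
      show "lc ` (S \<rightarrow> carrier R) \<subseteq> carrier M"
        unfolding lc_def using S by (auto intro!: M.finsum_closed)
      have "lc (\<lambda>_. \<zero>) = \<zero>\<^bsub>M\<^esub>"
        unfolding lc_def using S by (intro M.add.finprod_one_eqI) auto
      then show "\<zero>\<^bsub>M\<^esub> \<in> lc ` (S \<rightarrow> carrier R)" by (metis Pi_I R.zero_closed image_eqI)
    next
      fix x y assume "x \<in> lc ` (S \<rightarrow> carrier R)" "y \<in> lc ` (S \<rightarrow> carrier R)"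
      then obtain c d where cd: "c \<in> S \<rightarrow> carrier R" "d \<in> S \<rightarrow> carrier R" "x = lc c" "y = lc d" by blast
      have "lc (\<lambda>s. c s \<oplus> d s) = (\<Oplus>\<^bsub>M\<^esub>s\<in>S. c s \<odot>\<^bsub>M\<^esub> s \<oplus>\<^bsub>M\<^esub> d s \<odot>\<^bsub>M\<^esub> s)"
        unfolding lc_def using cd S by (intro M.finsum_cong') (auto simp: smult_l_distr Pi_iff subset_eq)
      also have "\<dots> = x \<oplus>\<^bsub>M\<^esub> y"
        unfolding cd lc_def using cd S by (intro M.finsum_addf) (auto simp: Pi_iff subset_eq)
      finally show "x \<oplus>\<^bsub>M\<^esub> y \<in> lc ` (S \<rightarrow> carrier R)"
        using cd by (intro image_eqI[where x = "\<lambda>s. c s \<oplus> d s"]) auto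
    next
      fix a x assume a: "a \<in> carrier R" and "x \<in> lc ` (S \<rightarrow> carrier R)"
      then obtain c where c: "c \<in> S \<rightarrow> carrier R" "x = lc c" by blast
      have "a \<odot>\<^bsub>M\<^esub> x = (\<Oplus>\<^bsub>M\<^esub>s\<in>S. a \<odot>\<^bsub>M\<^esub> (c s \<odot>\<^bsub>M\<^esub> s))"
        unfolding c lc_def using a c S by (intro smult_finsum) (auto simp: Pi_iff subset_eq)
      also have "\<dots> = lc (\<lambda>s. a \<otimes> c s)"
        unfolding lc_def using a c S by (intro M.finsum_cong') (auto simp: smult_assoc1 Pi_iff subset_eq)
      finally show "a \<odot>\<^bsub>M\<^esub> x \<in> lc ` (S \<rightarrow> carrier R)"
        using a c by (intro image_eqI[where x = "\<lambda>s. a \<otimes> c s"]) auto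
    qed
    show "S \<subseteq> lc ` (S \<rightarrow> carrier R)"
    proof
      fix t assume t: "t \<in> S"
      \<comment> \<open>The coefficient is left unsimplified so that the right side is literally the
        summand at \<open>t\<close>, as \<open>finsum_only\<close> yields it.\<close>
      have "lc (\<lambda>s. if s = t then \<one> else \<zero>) = (if t = t then \<one> else \<zero>) \<odot>\<^bsub>M\<^esub> t"
        unfolding lc_def using t S by (intro M.finsum_only) auto
      then have "t = lc (\<lambda>s. if s = t then \<one> else \<zero>)" using t S by auto
      then show "t \<in> lc ` (S \<rightarrow> carrier R)"
        by (intro image_eqI[where x = "\<lambda>s. if s = t then \<one> else \<zero>"]) auto
    qed
  qed
  then have "\<forall>x\<in>carrier M. \<exists>c\<in>S \<rightarrow> carrier R. x = (\<Oplus>\<^bsub>M\<^esub>s\<in>S. c s \<odot>\<^bsub>M\<^esub> s)"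
    unfolding lc_def by (auto simp only: image_iff subset_eq)
  with S show "finitely_generated R M"
    unfolding finitely_generated_def by (intro exI[where x = S] conjI)
qed

end

text \<open>The \<open>n\<close> coordinate functionals are bundled into one map \<open>s\<close> to
  \<open>R\<^sup>n\<close>. It splits the map from \<open>R\<^sup>n\<close> to \<open>P\<close>
  given by \<open>q\<close>, so a dual basis exhibits \<open>P\<close> as a direct summand of
  \<open>R\<^sup>n\<close>.\<close>

definition dual_basis ::
  "('r, 'x) ring_scheme \<Rightarrow> ('r, 'm, 'y) module_scheme \<Rightarrow> nat \<Rightarrow> (nat \<Rightarrow> 'm) \<Rightarrow> ('m \<Rightarrow> nat \<Rightarrow> 'r) \<Rightarrow> bool"
  where "dual_basis R P n q s \<longleftrightarrow>
    q \<in> {..<n} \<rightarrow> carrier P \<and> s \<in> left_module_hom R P (free_module R n) \<and>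
    (\<forall>x\<in>carrier P. x = (\<Oplus>\<^bsub>P\<^esub>i\<in>{..<n}. s x i \<odot>\<^bsub>P\<^esub> q i))"

lemma dual_basisD:
  assumes "dual_basis R P n q s"
  shows "q \<in> {..<n} \<rightarrow> carrier P" "s \<in> left_module_hom R P (free_module R n)"
    and "x \<in> carrier P \<Longrightarrow> s x i \<in> carrier R"
    and "x \<in> carrier P \<Longrightarrow> (\<Oplus>\<^bsub>P\<^esub>i\<in>{..<n}. s x i \<odot>\<^bsub>P\<^esub> q i) = x"
proof -
  show s: "s \<in> left_module_hom R P (free_module R n)" using assms by (simp add: dual_basis_def)
  show "x \<in> carrier P \<Longrightarrow> s x i \<in> carrier R" using left_module_homD(1)[OF s, of x] by simp
qed (use assms in \<open>simp_all add: dual_basis_def\<close>)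

lemma dual_basis_finitely_generated:
  assumes "left_module R P" and db: "dual_basis R P n q s"
  shows "finitely_generated R P"
proof -
  interpret P: left_module R P by fact
  have q: "q i \<in> carrier P" if "i < n" for i using dual_basisD(1)[OF db] that by auto
  have s: "s x i \<in> carrier R" if "x \<in> carrier P" for x i
    using dual_basisD(3)[OF db that] .
  have "x \<in> L" if L: "left_submodule R P L" "q ` {..<n} \<subseteq> L" and x: "x \<in> carrier P" for L x
  proof -
    have "(\<Oplus>\<^bsub>P\<^esub>i\<in>{..<n}. s x i \<odot>\<^bsub>P\<^esub> q i) \<in> L"
      by (rule left_submodule.finsum_in[OF L(1)]) (use L s x in \<open>auto intro: left_submodule.smult_in[OF L(1)]\<close>)
    then show ?thesis using dual_basisD(4)[OF db x] by simp
  qed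
  then show ?thesis
    unfolding P.finitely_generated_iff using q by (intro exI[where x = "q ` {..<n}"]) auto
qed

lemma dual_basis_projective:
  assumes "left_module R P" and db: "dual_basis R P n q s"
  shows "projective_module R P"
  unfolding projective_module_def
proof (intro allI impI, elim conjE)
  fix M N :: "('a, nat \<Rightarrow> 'a) module" and g f
  assume "left_module R M" "left_module R N" and g: "g \<in> left_module_hom R M N"
    and surj: "g ` carrier M = carrier N" and f: "f \<in> left_module_hom R P N"
  interpret P: left_module R P by fact
  interpret M: left_module R M by fact
  interpret N: left_module R N by fact
  note q = dual_basisD(1)[OF db] and s = dual_basisD(2)[OF db]
  have sR: "s x \<in> {..<n} \<rightarrow> carrier R" if "x \<in> carrier P" for x
    using dual_basisD(3)[OF db that] by blast
  have "\<exists>m. m \<in> carrier M \<and> g m = f (q i)" if "i < n" for i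
  proof -
    have "f (q i) \<in> g ` carrier M"
      using left_module_homD(1)[OF f] q that unfolding surj by auto
    then show ?thesis by (metis imageE)
  qed
  then obtain m where m: "\<And>i. i < n \<Longrightarrow> m i \<in> carrier M \<and> g (m i) = f (q i)" by metis
  then have mM: "m \<in> {..<n} \<rightarrow> carrier M" by auto
  \<comment> \<open>The values \<open>f (q i)\<close> are lifted individually, and the lifts are
    combined by means of the coordinates \<open>s\<close>, which recover every \<open>x\<close> from
    the \<open>q i\<close>.\<close>
  let ?h = "\<lambda>x. \<Oplus>\<^bsub>M\<^esub>i\<in>{..<n}. s x i \<odot>\<^bsub>M\<^esub> m i"
  have "?h \<in> left_module_hom R P M"
    using left_module_hom_comp[OF s M.linear_combination_hom[OF mM]] .
  moreover have "g (?h x) = f x" if x: "x \<in> carrier P" for x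
  proof -
    have "g (?h x) = (\<Oplus>\<^bsub>N\<^esub>i\<in>{..<n}. s x i \<odot>\<^bsub>N\<^esub> g (m i))"
      by (rule M.hom_linear_combination[OF N.left_module_axioms g mM sR[OF x]])
    also have "\<dots> = (\<Oplus>\<^bsub>N\<^esub>i\<in>{..<n}. s x i \<odot>\<^bsub>N\<^esub> f (q i))"
      by (rule N.M.finsum_cong') (use m sR[OF x] q left_module_homD(1)[OF f] in \<open>auto simp: Pi_iff\<close>)
    also have "\<dots> = f (\<Oplus>\<^bsub>P\<^esub>i\<in>{..<n}. s x i \<odot>\<^bsub>P\<^esub> q i)"
      by (rule P.hom_linear_combination[OF N.left_module_axioms f q sR[OF x], symmetric])
    also have "\<dots> = f x" using dual_basisD(4)[OF db x] by simp
    finally show ?thesis .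
  qed
  ultimately show "\<exists>h\<in>left_module_hom R P M. \<forall>x\<in>carrier P. g (h x) = f x"
    by (intro bexI[where x = ?h]) simp_all
qed

text \<open>The test modules in \<open>projective_module\<close> have elements in \<open>nat \<Rightarrow> 'r\<close>, hence so must \<open>P\<close>
  here, since its identity map is lifted.\<close>

lemma projective_dual_basis:
  fixes P :: "('r, nat \<Rightarrow> 'r, 'y) module_scheme"
  assumes "left_module R P" "projective_module R P"
    and "finite S" "S \<subseteq> carrier P" "\<And>L. \<lbrakk>left_submodule R P L; S \<subseteq> L\<rbrakk> \<Longrightarrow> carrier P \<subseteq> L"
  obtains n q s where "dual_basis R P n q s" "q ` {..<n} = S"
proof -
  interpret P: left_module R P by fact
  \<comment> \<open>\<open>q\<close> enumerates the given set \<open>S\<close> itself, so that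
    generators of degree \<open>e\<close> lead to a dual basis whose elements have degree
    \<open>e\<close>.\<close>
  obtain q where q: "bij_betw q {0..<card S} S"
    using ex_bij_betw_nat_finite[OF assms(3)] by blast
  define n where "n = card S"
  have qS: "q ` {..<n} = S" using q by (simp add: n_def bij_betw_def lessThan_atLeast0)
  then have qP: "q \<in> {..<n} \<rightarrow> carrier P" using assms(4) by auto
  \<comment> \<open>\<open>P\<close> may carry further fields, such as a grading, while the test
    modules are plain records.\<close>
  define N where "N = module.truncate P"
  have N: "carrier N = carrier P" "\<zero>\<^bsub>N\<^esub> = \<zero>\<^bsub>P\<^esub>" "x \<oplus>\<^bsub>N\<^esub> y = x \<oplus>\<^bsub>P\<^esub> y" "a \<odot>\<^bsub>N\<^esub> x = a \<odot>\<^bsub>P\<^esub> x" for x y a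
    by (simp_all add: N_def module.defs)
  have "left_module R N"
    by (rule left_module_transfer[OF P.left_module_axioms]) (simp_all add: N)
  let ?g = "\<lambda>x. \<Oplus>\<^bsub>P\<^esub>i\<in>{..<n}. x i \<odot>\<^bsub>P\<^esub> q i"
  have g: "?g \<in> left_module_hom R (free_module R n) P"
    by (rule P.linear_combination_hom[OF qP])
  have "carrier P \<subseteq> ?g ` carrier (free_module R n)"
  proof (rule assms(5))
    show "left_submodule R P (?g ` carrier (free_module R n))"
      by (rule submodule_image[OF P.left_module_free_module P.left_module_axioms g])
    show "S \<subseteq> ?g ` carrier (free_module R n)"
    proof
      fix t assume "t \<in> S"
      then obtain j where j: "j < n" "t = q j" using qS by blast
      let ?x = "\<lambda>i. if i = j then \<one>\<^bsub>R\<^esub> else \<zero>\<^bsub>R\<^esub>"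
      have "?g ?x = ?x j \<odot>\<^bsub>P\<^esub> q j"
        using j qP by (intro P.M.finsum_only) (auto simp: Pi_iff)
      then have "t = ?g ?x" using j qP by (simp add: Pi_iff)
      then show "t \<in> ?g ` carrier (free_module R n)"
        by (intro image_eqI[where x = ?x]) (use j in auto)
    qed
  qed
  then have surj: "?g ` carrier (free_module R n) = carrier N"
    using left_module_homD(1)[OF g] N(1) by blast
  have gN: "?g \<in> left_module_hom R (free_module R n) N" and id: "(\<lambda>x. x) \<in> left_module_hom R P N"
    using g by (auto simp: left_module_hom_def N)
  obtain s where s: "s \<in> left_module_hom R P (free_module R n)" "\<forall>x\<in>carrier P. ?g (s x) = x"
    using assms(2)[unfolded projective_module_def, rule_format,
        of "free_module R n" N ?g "\<lambda>x. x"] P.left_module_free_module[of n] \<open>left_module R N\<close> gN id surj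
    by blast
  then have "dual_basis R P n q s"
    using qP by (simp add: dual_basis_def)
  then show ?thesis using that qS by blast
qed

section \<open>Graded projective modules\<close>

context strongly_graded_module
begin

text \<open>The elements generated by some finite set of elements of degree \<open>e\<close> form a
  submodule that contains the component of degree \<open>e\<close>, so by
  \<open>in_submodule\<close> it is all of \<open>M\<close>. Each of the finitely many given
  generators contributes one such finite set.\<close>

lemma finite_generators_in_identity_part:
  assumes "finitely_generated R M"
  shows "\<exists>Q. finite Q \<and> Q \<subseteq> component M \<one>\<^bsub>G\<^esub> \<and> (\<forall>L. left_submodule R M L \<and> Q \<subseteq> L \<longrightarrow> carrier M \<subseteq> L)"
proof -
  let ?C = "component M \<one>\<^bsub>G\<^esub>"
  \<comment> \<open>\<open>gen Q x\<close> says that \<open>x\<close> lies in the submodule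
    generated by \<open>Q\<close>.\<close>
  define gen where "gen Q x \<longleftrightarrow> (\<forall>L. left_submodule R M L \<and> Q \<subseteq> L \<longrightarrow> x \<in> L)" for Q x
  have gen_mono: "gen Q x" if "gen Q' x" "Q' \<subseteq> Q" for Q Q' x
    using that by (auto simp: gen_def)
  define L where "L = {x \<in> carrier M. \<exists>Q. finite Q \<and> Q \<subseteq> ?C \<and> gen Q x}"
  have "left_submodule R M L"
  proof
    show "\<zero>\<^bsub>M\<^esub> \<in> L"
      unfolding L_def gen_def by (auto intro!: exI[where x = "{}"] left_submodule.zero_in)
  next
    fix x y assume "x \<in> L" "y \<in> L"
    then obtain Q Q' where Q: "finite Q" "Q \<subseteq> ?C" "gen Q x" "finite Q'" "Q' \<subseteq> ?C" "gen Q' y"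
      and xy: "x \<in> carrier M" "y \<in> carrier M"
      unfolding L_def by blast
    have "gen (Q \<union> Q') x" "gen (Q \<union> Q') y" using Q gen_mono by blast+
    then have "gen (Q \<union> Q') (x \<oplus>\<^bsub>M\<^esub> y)"
      unfolding gen_def using left_submodule.add_in by metis
    then show "x \<oplus>\<^bsub>M\<^esub> y \<in> L"
      using Q xy unfolding L_def by (auto intro!: exI[where x = "Q \<union> Q'"])
  next
    fix a x assume a: "a \<in> carrier R" and "x \<in> L"
    then obtain Q where Q: "finite Q" "Q \<subseteq> ?C" "gen Q x" "x \<in> carrier M" unfolding L_def by blast
    then have "gen Q (a \<odot>\<^bsub>M\<^esub> x)"
      unfolding gen_def using left_submodule.smult_in a by metis
    then show "a \<odot>\<^bsub>M\<^esub> x \<in> L" using Q a unfolding L_def by auto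
  qed (auto simp: L_def)
  moreover have "x \<in> L" if "x \<in> ?C" for x
    unfolding L_def gen_def using that gm.summand_closed[OF grp.one_closed that]
    by (auto intro!: exI[where x = "{x}"])
  ultimately have carrier_L: "carrier M \<subseteq> L"
    using in_submodule smult_inv_in by blast
  obtain S where S: "finite S" "S \<subseteq> carrier M"
    and genS: "\<forall>L. left_submodule R M L \<and> S \<subseteq> L \<longrightarrow> carrier M \<subseteq> L"
    using assms[unfolded lm.finitely_generated_iff] by (elim exE conjE)
  have "\<forall>s\<in>S. \<exists>Q. finite Q \<and> Q \<subseteq> ?C \<and> gen Q s" using S(2) carrier_L unfolding L_def by blast
  then obtain Q where Q: "\<And>s. s \<in> S \<Longrightarrow> finite (Q s) \<and> Q s \<subseteq> ?C \<and> gen (Q s) s" by metis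
  have "gen (\<Union>s\<in>S. Q s) x" if x: "x \<in> carrier M" for x
    unfolding gen_def
  proof (intro allI impI, elim conjE)
    fix L assume L: "left_submodule R M L" "(\<Union>s\<in>S. Q s) \<subseteq> L"
    have "s \<in> L" if s: "s \<in> S" for s
    proof -
      have "Q s \<subseteq> L" using L(2) s by blast
      then show ?thesis using Q[OF s] L(1) unfolding gen_def by simp
    qed
    then have "S \<subseteq> L" by (rule subsetI)
    then have "carrier M \<subseteq> L" using genS L(1) by simp
    then show "x \<in> L" using x by (rule subsetD)
  qed
  then have "\<forall>L. left_submodule R M L \<and> (\<Union>s\<in>S. Q s) \<subseteq> L \<longrightarrow> carrier M \<subseteq> L"
    unfolding gen_def by (intro allI impI subsetI) simp
  moreover have "finite (\<Union>s\<in>S. Q s)" "(\<Union>s\<in>S. Q s) \<subseteq> ?C" using Q S(1) by auto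
  ultimately show ?thesis by (intro exI[where x = "\<Union>s\<in>S. Q s"] conjI)
qed

lemma finsum_identity_part:
  assumes "f \<in> I \<rightarrow> component M \<one>\<^bsub>G\<^esub>"
  shows "(\<Oplus>\<^bsub>identity_part G M\<^esub>i\<in>I. f i) = (\<Oplus>\<^bsub>M\<^esub>i\<in>I. f i)"
  using left_module_identity_part gm.summand_closed[OF grp.one_closed] assms
  by (intro finsum_inclusion) (auto simp: left_module_def lm.M.abelian_group_axioms)

end

text \<open>The dual basis is chosen with all \<open>q i\<close> of degree \<open>e\<close>. Its
  coordinates \<open>s x i\<close> may have parts in every degree, but for \<open>x\<close> of
  degree \<open>e\<close> the part of degree \<open>e\<close> of the sum of the
  \<open>s x i q i\<close> involves only the parts of degree \<open>e\<close> of the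
  coordinates.\<close>

lemma (in strongly_graded_ring) identity_part_fg_projective:
  fixes P :: "('g, 'r, nat \<Rightarrow> 'r) graded_module"
  assumes "P \<in> graded_fg_projectives G R A"
  shows "identity_part G P \<in> fg_projectives B"
proof -
  have P: "is_graded_module G R A P" "finitely_generated R P" "projective_module R P"
    using assms by (auto simp: graded_fg_projectives_def)
  interpret P: strongly_graded_module G R A P using strongly_graded_moduleI[OF P(1)] .
  have e: "\<one>\<^bsub>G\<^esub> \<in> carrier G" by simp
  obtain Q where Q: "finite Q" "Q \<subseteq> component P \<one>\<^bsub>G\<^esub>"
    and genQ: "\<forall>L. left_submodule R P L \<and> Q \<subseteq> L \<longrightarrow> carrier P \<subseteq> L"
    using P.finite_generators_in_identity_part[OF P(2)] by (elim exE conjE)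
  have QP: "Q \<subseteq> carrier P" using Q(2) P.gm.summand_closed[OF e] by blast
  obtain n q s where db: "dual_basis R P n q s" and qQ: "q ` {..<n} = Q"
    using projective_dual_basis[OF P.lm.left_module_axioms P(3) Q(1) QP] genQ by blast
  have q: "q i \<in> component P \<one>\<^bsub>G\<^esub>" if "i < n" for i using qQ Q(2) that by blast
  have s_closed: "s x i \<in> carrier R" "n \<le> i \<Longrightarrow> s x i = \<zero>" if "x \<in> component P \<one>\<^bsub>G\<^esub>" for x i
    using left_module_homD(1)[OF dual_basisD(2)[OF db]] P.gm.summand_closed[OF e that] by auto
  define s' where "s' x i = grd.pr \<one>\<^bsub>G\<^esub> (s x i)" for x i
  have s'_closed: "s' x i \<in> A \<one>\<^bsub>G\<^esub>" if "x \<in> component P \<one>\<^bsub>G\<^esub>" for x i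
    using s_closed[OF that] by (simp add: s'_def grd.part_in)
  have "dual_basis B (identity_part G P) n q s'"
    unfolding dual_basis_def
  proof (intro conjI ballI)
    show "q \<in> {..<n} \<rightarrow> carrier (identity_part G P)" using q by auto
    have "s' (x \<oplus>\<^bsub>P\<^esub> y) = (\<lambda>i. s' x i \<oplus> s' y i)" if "x \<in> component P \<one>\<^bsub>G\<^esub>" "y \<in> component P \<one>\<^bsub>G\<^esub>" for x y
      using that s_closed left_module_homD(2)[OF dual_basisD(2)[OF db], of x y] P.gm.summand_closed[OF e]
      by (auto simp: s'_def grd.part_add)
    \<comment> \<open>Linearity over \<open>R\<^sub>e\<close>: multiplication by an element of
      degree \<open>e\<close> commutes with taking parts.\<close>
    moreover have "s' (a \<odot>\<^bsub>P\<^esub> x) = (\<lambda>i. a \<otimes> s' x i)" if "a \<in> A \<one>\<^bsub>G\<^esub>" "x \<in> component P \<one>\<^bsub>G\<^esub>" for a x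
      using that s_closed left_module_homD(3)[OF dual_basisD(2)[OF db], of a x] P.gm.summand_closed[OF e]
        grd.summand_closed[OF e] part_mult_left[OF e e]
      by (auto simp: s'_def)
    ultimately show "s' \<in> left_module_hom B (identity_part G P) (free_module B n)"
      using s'_closed s_closed by (auto simp: left_module_hom_def s'_def grd.part_zero)
    fix x assume "x \<in> carrier (identity_part G P)"
    then have x: "x \<in> component P \<one>\<^bsub>G\<^esub>" "x \<in> carrier P" using P.gm.summand_closed[OF e] by auto
    interpret pr: abelian_group_hom P P "P.gm.pr \<one>\<^bsub>G\<^esub>" using P.gm.part_hom[OF e] .
    have "x = P.gm.pr \<one>\<^bsub>G\<^esub> (\<Oplus>\<^bsub>P\<^esub>i\<in>{..<n}. s x i \<odot>\<^bsub>P\<^esub> q i)"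
      using dual_basisD(4)[OF db x(2)] P.gm.part_same[OF e x(1)] by simp
    also have "\<dots> = (\<Oplus>\<^bsub>P\<^esub>i\<in>{..<n}. P.gm.pr \<one>\<^bsub>G\<^esub> (s x i \<odot>\<^bsub>P\<^esub> q i))"
      using q s_closed(1)[OF x(1)] P.gm.summand_closed[OF e] by (intro pr.hom_finsum) auto
    also have "\<dots> = (\<Oplus>\<^bsub>P\<^esub>i\<in>{..<n}. s' x i \<odot>\<^bsub>P\<^esub> q i)"
      using q s_closed(1)[OF x(1)] P.gm.summand_closed[OF e] s'_closed[OF x(1)] grd.summand_closed[OF e]
      by (intro P.lm.M.finsum_cong') (auto simp: s'_def P.part_smult_right)
    also have "\<dots> = (\<Oplus>\<^bsub>identity_part G P\<^esub>i\<in>{..<n}. s' x i \<odot>\<^bsub>identity_part G P\<^esub> q i)"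
      unfolding identity_part_simps
      using q s'_closed[OF x(1)] P.smult_component[OF e e] by (intro P.finsum_identity_part[symmetric]) auto
    finally show "x = (\<Oplus>\<^bsub>identity_part G P\<^esub>i\<in>{..<n}. s' x i \<odot>\<^bsub>identity_part G P\<^esub> q i)" .
  qed
  then show ?thesis
    using P.left_module_identity_part dual_basis_finitely_generated dual_basis_projective
    by (auto simp: fg_projectives_def)
qed

section \<open>Graded modules built from modules over \<open>R\<^sub>e\<close>\<close>

definition graded_free_module ::
  "('r, 'y) ring_scheme \<Rightarrow> ('g \<Rightarrow> 'r set) \<Rightarrow> nat \<Rightarrow> ('g, 'r, nat \<Rightarrow> 'r) graded_module"
  where "graded_free_module R A n = module.extend (free_module R n)
    \<lparr>component = (\<lambda>\<gamma>. {x \<in> carrier (free_module R n). \<forall>i. x i \<in> A \<gamma>})\<rparr>"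

lemma graded_free_module_simps [simp]:
  "carrier (graded_free_module R A n) = carrier (free_module R n)"
  "\<zero>\<^bsub>graded_free_module R A n\<^esub> = (\<lambda>i. \<zero>\<^bsub>R\<^esub>)"
  "x \<oplus>\<^bsub>graded_free_module R A n\<^esub> y = (\<lambda>i. x i \<oplus>\<^bsub>R\<^esub> y i)"
  "a \<odot>\<^bsub>graded_free_module R A n\<^esub> x = (\<lambda>i. a \<otimes>\<^bsub>R\<^esub> x i)"
  "component (graded_free_module R A n) \<gamma> = {x \<in> carrier (free_module R n). \<forall>i. x i \<in> A \<gamma>}"
  by (simp_all add: graded_free_module_def module.defs graded_module.defs free_module_def)

text \<open>Parts are taken coordinatewise, and only finitely many degrees occur because at most
  \<open>n\<close> coordinates are nonzero. All basis vectors have degree \<open>e\<close>, so the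
  component of degree \<open>e\<close> consists of the vectors over
  \<open>R\<^sub>e\<close>.\<close>

lemma (in strongly_graded_ring) strongly_graded_free_module:
  "strongly_graded_module G R A (graded_free_module R A n)"
proof -
  let ?F = "graded_free_module R A n"
  interpret F: left_module R ?F
    by (rule left_module_transfer[OF left_module_free_module[of n]]) auto
  define p where "p \<gamma> x i = grd.pr \<gamma> (x i)" for \<gamma> and x :: "nat \<Rightarrow> 'r" and i
  have supp: "finite {\<gamma>\<in>carrier G. p \<gamma> x \<noteq> \<zero>\<^bsub>?F\<^esub>}"
    "{\<gamma>\<in>carrier G. grd.pr \<gamma> (x i) \<noteq> \<zero>} \<subseteq> {\<gamma>\<in>carrier G. p \<gamma> x \<noteq> \<zero>\<^bsub>?F\<^esub>}" if x: "x \<in> carrier ?F" for x i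
  proof -
    have "{\<gamma>\<in>carrier G. p \<gamma> x \<noteq> \<zero>\<^bsub>?F\<^esub>} \<subseteq> (\<Union>i<n. {\<gamma>\<in>carrier G. grd.pr \<gamma> (x i) \<noteq> \<zero>})"
    proof safe
      fix \<gamma> assume \<gamma>: "\<gamma> \<in> carrier G" and "p \<gamma> x \<noteq> \<zero>\<^bsub>?F\<^esub>"
      then obtain i where "grd.pr \<gamma> (x i) \<noteq> \<zero>" by (auto simp: p_def fun_eq_iff)
      moreover from this have "i < n"
        using x \<gamma> grd.part_zero by (intro not_le_imp_less notI) auto
      ultimately show "\<gamma> \<in> (\<Union>i<n. {\<gamma>\<in>carrier G. grd.pr \<gamma> (x i) \<noteq> \<zero>})" using \<gamma> by blast
    qed
    moreover have "finite (\<Union>i<n. {\<gamma>\<in>carrier G. grd.pr \<gamma> (x i) \<noteq> \<zero>})"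
      using x grd.finite_parts by auto
    ultimately show "finite {\<gamma>\<in>carrier G. p \<gamma> x \<noteq> \<zero>\<^bsub>?F\<^esub>}" using finite_subset by blast
    show "{\<gamma>\<in>carrier G. grd.pr \<gamma> (x i) \<noteq> \<zero>} \<subseteq> {\<gamma>\<in>carrier G. p \<gamma> x \<noteq> \<zero>\<^bsub>?F\<^esub>}"
      by (auto simp: p_def fun_eq_iff)
  qed
  have p_closed: "p \<gamma> x \<in> carrier ?F" if "\<gamma> \<in> carrier G" "x \<in> carrier ?F" for \<gamma> x
    using that by (auto simp: p_def grd.part_closed grd.part_zero)
  have "direct_sum ?F (carrier G) (component ?F)"
  proof (rule direct_sumI[where p = p])
    fix \<gamma> assume \<gamma>: "\<gamma> \<in> carrier G"
    interpret A: additive_subgroup "A \<gamma>" R using grd.summand_subgroup[OF \<gamma>] .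
    \<comment> \<open>Evaluation at \<open>i\<close> is additive, hence carries the negative in
      \<open>?F\<close> to that in \<open>R\<close>.\<close>
    have minus: "(\<ominus>\<^bsub>?F\<^esub> x) i = \<ominus> x i" if "x \<in> carrier ?F" for x i
    proof -
      interpret ev: abelian_group_hom ?F R "\<lambda>x. x i"
        by (intro abelian_group_homI') (auto simp: F.M.abelian_group_axioms abelian_group_axioms)
      show ?thesis using that by simp
    qed
    show "additive_subgroup (component ?F \<gamma>) ?F"
    proof (rule additive_subgroup.intro, rule F.M.add.subgroupI)
      fix x assume "x \<in> component ?F \<gamma>"
      then have x: "x \<in> carrier ?F" "\<And>i. x i \<in> A \<gamma>" by auto
      then show "\<ominus>\<^bsub>?F\<^esub> x \<in> component ?F \<gamma>"
        using F.M.a_inv_closed[OF x(1)] minus[OF x(1)] A.a_inv_closed by auto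
    next
      have "(\<lambda>i. \<zero>) \<in> component ?F \<gamma>" by simp
      then show "component ?F \<gamma> \<noteq> {}" by blast
    qed auto
    show "abelian_group_hom ?F ?F (p \<gamma>)"
      using p_closed[OF \<gamma>] \<gamma>
      by (intro abelian_group_homI') (auto simp: F.M.abelian_group_axioms p_def grd.part_add)
  next
    fix x assume x: "x \<in> carrier ?F"
    show "x = (\<Oplus>\<^bsub>?F\<^esub>\<gamma>\<in>{\<gamma>\<in>carrier G. p \<gamma> x \<noteq> \<zero>\<^bsub>?F\<^esub>}. p \<gamma> x)" (is "_ = (\<Oplus>\<^bsub>?F\<^esub>\<gamma>\<in>?J. p \<gamma> x)")
    proof
      fix i
      interpret ev: abelian_group_hom ?F R "\<lambda>x. x i"
        by (intro abelian_group_homI') (auto simp: F.M.abelian_group_axioms abelian_group_axioms)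
      \<comment> \<open>\<open>?J\<close> collects the degrees that occur in any coordinate, so it
        may exceed the support of \<open>x i\<close>.\<close>
      have "x i = (\<Oplus>\<gamma>\<in>?J. grd.pr \<gamma> (x i))"
        using x supp[OF x] by (intro grd.sum_parts_superset) auto
      also have "\<dots> = (\<Oplus>\<^bsub>?F\<^esub>\<gamma>\<in>?J. p \<gamma> x) i"
        using ev.hom_finsum[of "\<lambda>\<gamma>. p \<gamma> x" ?J] p_closed x by (simp add: p_def)
      finally show "x i = (\<Oplus>\<^bsub>?F\<^esub>\<gamma>\<in>?J. p \<gamma> x) i" .
    qed
  next
    fix \<gamma> x assume \<gamma>: "\<gamma> \<in> carrier G" and x: "x \<in> carrier ?F"
    show "p \<gamma> x \<in> component ?F \<gamma>"
      using p_closed[OF \<gamma> x] \<gamma> x by (auto simp: p_def grd.part_in)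
  qed (use supp grd.part_same grd.part_other in \<open>auto simp: p_def F.M.abelian_group_axioms\<close>)
  moreover have "strongly_graded_module_axioms G A ?F"
    by (auto simp: strongly_graded_module_axioms_def mult_in grd.summand_closed)
  ultimately show ?thesis
    using strongly_graded_ring_axioms F.left_module_axioms by (simp add: strongly_graded_module_def)
qed

text \<open>The parts of an element of \<open>L\<close> stay in \<open>L\<close>, so the projections
  of \<open>M\<close> restrict to \<open>L\<close> and \<open>direct_sumI\<close> applies.\<close>

lemma (in graded_submodule) strongly_graded_submodule:
  "strongly_graded_module G R A (M\<lparr>carrier := L, component := (\<lambda>\<gamma>. L \<inter> component M \<gamma>)\<rparr>)"
    (is "strongly_graded_module G R A ?L")
proof -
  have minus_in: "\<ominus>\<^bsub>M\<^esub> x \<in> L" if x: "x \<in> L" for x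
  proof -
    \<comment> \<open>A submodule is defined by closure under sums and scalars; negatives come as
      multiples by \<open>\<ominus> \<one>\<close>.\<close>
    have "\<ominus>\<^bsub>M\<^esub> x = (\<ominus> \<one>) \<odot>\<^bsub>M\<^esub> x"
      using abelian_group_hom.hom_a_inv[OF lm.smult_hom'[of x], of \<one>] x subset lm.smult_one by auto
    then show ?thesis using smult_in x by simp
  qed
  have "abelian_group ?L"
  proof (rule abelian_groupI)
    fix x assume "x \<in> carrier ?L"
    then show "\<exists>y\<in>carrier ?L. y \<oplus>\<^bsub>?L\<^esub> x = \<zero>\<^bsub>?L\<^esub>"
      using minus_in lm.M.l_neg subset by auto
  qed (use zero_in add_in subset in \<open>auto simp: lm.M.a_ac subset_eq\<close>)
  then have lm: "left_module R ?L"
    using smult_in subset lm.left_module_axioms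
    by (auto simp: left_module_def left_module_axioms_def subset_eq)
  interpret L: left_module R ?L by fact
  have "direct_sum ?L (carrier G) (component ?L)"
  proof (rule direct_sumI[where p = gm.pr])
    fix \<gamma> assume \<gamma>: "\<gamma> \<in> carrier G"
    interpret C: additive_subgroup "component M \<gamma>" M using gm.summand_subgroup[OF \<gamma>] .
    show "additive_subgroup (component ?L \<gamma>) ?L"
    proof (rule additive_subgroup.intro, rule L.M.add.subgroupI)
      fix x assume "x \<in> component ?L \<gamma>"
      then have x: "x \<in> L" "x \<in> component M \<gamma>" by auto
      have "\<ominus>\<^bsub>?L\<^esub> x = \<ominus>\<^bsub>M\<^esub> x"
        using x minus_in subset lm.M.r_neg by (intro L.M.minus_equality) (auto simp: subset_eq lm.M.l_neg)
      then show "\<ominus>\<^bsub>?L\<^esub> x \<in> component ?L \<gamma>" using minus_in x C.a_inv_closed by simp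
    qed (use zero_in C.zero_closed add_in in auto)
    show "abelian_group_hom ?L ?L (gm.pr \<gamma>)"
      using parts_in[OF \<gamma>] gm.part_add[OF _ _ \<gamma>] subset
      by (intro abelian_group_homI') (auto simp: L.M.abelian_group_axioms subset_eq)
  next
    fix x assume "x \<in> carrier ?L"
    then have x: "x \<in> L" "x \<in> carrier M" using subset by auto
    show "finite {\<gamma> \<in> carrier G. gm.pr \<gamma> x \<noteq> \<zero>\<^bsub>?L\<^esub>}" using gm.finite_parts[OF x(2)] by simp
    have "(\<Oplus>\<^bsub>?L\<^esub>\<gamma>\<in>{\<gamma> \<in> carrier G. gm.pr \<gamma> x \<noteq> \<zero>\<^bsub>M\<^esub>}. gm.pr \<gamma> x) =
        (\<Oplus>\<^bsub>M\<^esub>\<gamma>\<in>{\<gamma> \<in> carrier G. gm.pr \<gamma> x \<noteq> \<zero>\<^bsub>M\<^esub>}. gm.pr \<gamma> x)"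
      using subset x parts_in
      by (intro finsum_inclusion) (auto simp: L.M.abelian_group_axioms lm.M.abelian_group_axioms)
    then show "x = (\<Oplus>\<^bsub>?L\<^esub>\<gamma>\<in>{\<gamma> \<in> carrier G. gm.pr \<gamma> x \<noteq> \<zero>\<^bsub>?L\<^esub>}. gm.pr \<gamma> x)"
      using gm.sum_parts[OF x(2)] by simp
  next
    fix \<gamma> x assume "\<gamma> \<in> carrier G" "x \<in> carrier ?L"
    then show "gm.pr \<gamma> x \<in> component ?L \<gamma>" using parts_in gm.part_in subset by auto
  qed (auto simp: L.M.abelian_group_axioms gm.part_same gm.part_other)
  moreover have "strongly_graded_module_axioms G A ?L"
    using smult_in smult_component grd.summand_closed by (auto simp: strongly_graded_module_axioms_def)
  ultimately show ?thesis
    using strongly_graded_ring_axioms lm by (simp add: strongly_graded_module_def)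
qed

text \<open>A dual basis of \<open>Q\<close> exhibits it as the image of an idempotent matrix over \<open>R\<^sub>e\<close>, with rows \<open>E i\<close>;
  the same matrix over \<open>R\<close> has as image the graded module corresponding to \<open>Q\<close>.\<close>

lemma (in strongly_graded_ring) graded_projective_of_fg_projective:
  fixes Q :: "('r, nat \<Rightarrow> 'r) module"
  assumes "Q \<in> fg_projectives B"
  shows "\<exists>P\<in>graded_fg_projectives G R A. \<exists>f\<in>left_module_hom B (identity_part G P) Q.
    bij_betw f (carrier (identity_part G P)) (carrier Q)"
proof -
  have Q: "left_module B Q" "finitely_generated B Q" "projective_module B Q"
    using assms by (auto simp: fg_projectives_def)
  interpret B: ring B by (rule ring_e)
  interpret Q: left_module B Q by fact
  have e: "\<one>\<^bsub>G\<^esub> \<in> carrier G" by simp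
  note A_closed = grd.summand_closed[OF e]
  obtain S where S: "finite S" "S \<subseteq> carrier Q"
    and genS: "\<forall>L. left_submodule B Q L \<and> S \<subseteq> L \<longrightarrow> carrier Q \<subseteq> L"
    using Q(2)[unfolded Q.finitely_generated_iff] by (elim exE conjE)
  obtain n q s where db: "dual_basis B Q n q s"
    by (rule projective_dual_basis[OF Q(1,3) S]) (use genS in simp)
  note q = dual_basisD(1)[OF db] and s = dual_basisD(2)[OF db]
  let ?F = "graded_free_module R A n" and ?FB = "free_module B n"
  interpret F: strongly_graded_module G R A ?F by (rule strongly_graded_free_module)
  interpret FF: strongly_graded_module_pair G R A ?F ?F
    by (simp add: strongly_graded_module_pair_def F.strongly_graded_module_axioms)
  interpret FB: left_module B ?FB by (rule B.left_module_free_module)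
  have sF: "s x \<in> component ?F \<one>\<^bsub>G\<^esub>" if "x \<in> carrier Q" for x
    using left_module_homD(1)[OF s that] A_closed by auto
  define E where "E i = s (q i)" for i
  have E: "E i \<in> component ?F \<one>\<^bsub>G\<^esub>" if "i < n" for i
    unfolding E_def using q that sF by blast
  \<comment> \<open>\<open>\<pi>\<close> multiplies a row vector over \<open>R\<close> by the matrix
    with rows \<open>E i\<close>.\<close>
  define \<pi> where "\<pi> x = (\<Oplus>\<^bsub>?F\<^esub>i\<in>{..<n}. x i \<odot>\<^bsub>?F\<^esub> E i)" for x
  have "E \<in> {..<n} \<rightarrow> carrier ?F" using E F.gm.summand_closed[OF e] by blast
  from F.lm.linear_combination_hom[OF this]
  have \<pi>_lin: "\<pi> \<in> left_module_hom R ?F ?F"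
    by (simp add: left_module_hom_def \<pi>_def Pi_iff)
  have \<pi>: "\<pi> \<in> graded_hom G R ?F ?F"
    unfolding graded_hom_def
  proof (intro CollectI conjI ballI subsetI \<pi>_lin)
    fix \<gamma> y assume \<gamma>: "\<gamma> \<in> carrier G" and "y \<in> \<pi> ` component ?F \<gamma>"
    then obtain x where x: "x \<in> component ?F \<gamma>" "y = \<pi> x" by blast
    show "y \<in> component ?F \<gamma>"
      unfolding x(2) \<pi>_def
    proof (rule F.lm.M.finsum_in_closed_set)
      show "\<zero>\<^bsub>?F\<^esub> \<in> component ?F \<gamma>" by (rule F.gm.summand_zero[OF \<gamma>])
      show "u \<oplus>\<^bsub>?F\<^esub> v \<in> component ?F \<gamma>" if "u \<in> component ?F \<gamma>" "v \<in> component ?F \<gamma>" for u v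
        by (rule F.gm.summand_add[OF \<gamma> that])
      show "component ?F \<gamma> \<subseteq> carrier ?F" using F.gm.summand_closed[OF \<gamma>] by blast
      show "x i \<odot>\<^bsub>?F\<^esub> E i \<in> component ?F \<gamma>" if "i \<in> {..<n}" for i
        using F.smult_component[OF \<gamma> e, of "x i" "E i"] E that x(1) \<gamma> by simp
    qed
  qed
  \<comment> \<open>On vectors over \<open>R\<^sub>e\<close>, \<open>\<pi>\<close> is the map to
    \<open>Q\<close> given by \<open>q\<close>, followed by \<open>s\<close>. As the former undoes
    \<open>s\<close>, \<open>\<pi>\<close> fixes the image of \<open>s\<close>.\<close>
  have \<pi>_eq: "\<pi> x = s (\<Oplus>\<^bsub>Q\<^esub>i\<in>{..<n}. x i \<odot>\<^bsub>Q\<^esub> q i)" if x: "x \<in> component ?F \<one>\<^bsub>G\<^esub>" for x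
  proof -
    have "s (\<Oplus>\<^bsub>Q\<^esub>i\<in>{..<n}. x i \<odot>\<^bsub>Q\<^esub> q i) = (\<Oplus>\<^bsub>?FB\<^esub>i\<in>{..<n}. x i \<odot>\<^bsub>?FB\<^esub> s (q i))"
      using x by (intro Q.hom_linear_combination[OF FB.left_module_axioms s q]) auto
    also have "\<dots> = (\<Oplus>\<^bsub>?F\<^esub>i\<in>{..<n}. x i \<odot>\<^bsub>?FB\<^esub> s (q i))"
    proof (rule finsum_inclusion)
      show "carrier ?FB \<subseteq> carrier ?F" using A_closed by auto
      show "(\<lambda>i. x i \<odot>\<^bsub>?FB\<^esub> s (q i)) \<in> {..<n} \<rightarrow> carrier ?FB"
        using x q left_module_homD(1)[OF s] by (intro Pi_I FB.smult_closed) auto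
    qed (auto simp: FB.M.abelian_group_axioms F.lm.M.abelian_group_axioms)
    finally show ?thesis by (simp add: \<pi>_def E_def)
  qed
  have \<pi>_s: "\<pi> (s x) = s x" if "x \<in> carrier Q" for x
    using \<pi>_eq[OF sF[OF that]] dual_basisD(4)[OF db that] by simp

  \<comment> \<open>The fixed points of \<open>\<pi>\<close> are its image, since
    \<open>\<pi>\<close> fixes every \<open>E i\<close> by \<open>\<pi>_s\<close>. The equation
    \<open>\<pi> x = x\<close> is the dual basis identity with elements \<open>E i\<close> and the
    entries of \<open>x\<close> as coordinates.\<close>
  define L where "L = {x \<in> carrier ?F. \<pi> x = x}"
  interpret L: graded_submodule G R A ?F L
  proof unfold_locales
    interpret \<pi>: abelian_group_hom ?F ?F \<pi>
      by (rule left_module_hom_additive[OF F.lm.left_module_axioms F.lm.left_module_axioms \<pi>_lin])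
    show "\<zero>\<^bsub>?F\<^esub> \<in> L" using \<pi>.hom_zero F.lm.M.zero_closed by (simp add: L_def)
    show "x \<oplus>\<^bsub>?F\<^esub> y \<in> L" if "x \<in> L" "y \<in> L" for x y
      using that \<pi>.hom_add F.lm.M.a_closed by (simp add: L_def)
    show "a \<odot>\<^bsub>?F\<^esub> x \<in> L" if "a \<in> carrier R" "x \<in> L" for a x
      using that left_module_homD(3)[OF \<pi>_lin, of a x] by (simp add: L_def)
    show "F.gm.pr \<gamma> x \<in> L" if "\<gamma> \<in> carrier G" "x \<in> L" for \<gamma> x
      using that FF.graded_hom_part[OF \<pi>, of \<gamma> x] F.gm.part_closed[of \<gamma> x] unfolding L_def by force
  qed (auto simp: L_def)
  define P where "P = ?F\<lparr>carrier := L, component := (\<lambda>\<gamma>. L \<inter> component ?F \<gamma>)\<rparr>"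
  have P_simps: "carrier P = L" "component P \<gamma> = L \<inter> component ?F \<gamma>" "\<zero>\<^bsub>P\<^esub> = \<zero>\<^bsub>?F\<^esub>"
    "x \<oplus>\<^bsub>P\<^esub> y = x \<oplus>\<^bsub>?F\<^esub> y" "a \<odot>\<^bsub>P\<^esub> x = a \<odot>\<^bsub>?F\<^esub> x" for \<gamma> x y a
    by (simp_all add: P_def)
  interpret P: strongly_graded_module G R A P
    unfolding P_def by (rule L.strongly_graded_submodule)
  have EL: "E i \<in> L" if "i < n" for i
    using E[OF that] \<pi>_s[of "q i"] q that by (auto simp: L_def E_def)
  have "dual_basis R P n E (\<lambda>x. x)"
    unfolding dual_basis_def
  proof (intro conjI ballI)
    show "E \<in> {..<n} \<rightarrow> carrier P" using EL by (simp add: P_simps)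
    show "(\<lambda>x. x) \<in> left_module_hom R P (free_module R n)"
      by (auto simp: left_module_hom_def P_simps L_def)
    fix x assume "x \<in> carrier P"
    then have x: "x \<in> L" "\<And>i. x i \<in> carrier R" by (auto simp: P_simps L_def)
    have "(\<Oplus>\<^bsub>P\<^esub>i\<in>{..<n}. x i \<odot>\<^bsub>P\<^esub> E i) = (\<Oplus>\<^bsub>?F\<^esub>i\<in>{..<n}. x i \<odot>\<^bsub>P\<^esub> E i)"
    proof (rule finsum_inclusion)
      show "(\<lambda>i. x i \<odot>\<^bsub>P\<^esub> E i) \<in> {..<n} \<rightarrow> carrier P"
        using EL x L.smult_in unfolding P_simps by blast
    qed (auto simp: P.lm.M.abelian_group_axioms F.lm.M.abelian_group_axioms P_simps L_def)
    also have "\<dots> = \<pi> x" by (simp add: \<pi>_def P_simps)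
    finally show "x = (\<Oplus>\<^bsub>P\<^esub>i\<in>{..<n}. x i \<odot>\<^bsub>P\<^esub> E i)" using x(1) by (simp add: L_def)
  qed
  then have "P \<in> graded_fg_projectives G R A"
    using P.is_graded_module dual_basis_finitely_generated[OF P.lm.left_module_axioms]
      dual_basis_projective[OF P.lm.left_module_axioms]
    by (auto simp: graded_fg_projectives_def)

  \<comment> \<open>The inverse of \<open>f\<close> on the component of degree \<open>e\<close> is
    \<open>s\<close>: there \<open>s (f x) = \<pi> x = x\<close>, while \<open>f (s x) = x\<close>
    is the dual basis identity of \<open>Q\<close>.\<close>
  moreover define f where "f x = (\<Oplus>\<^bsub>Q\<^esub>i\<in>{..<n}. x i \<odot>\<^bsub>Q\<^esub> q i)" for x
  have Pe: "x \<in> component P \<one>\<^bsub>G\<^esub> \<longleftrightarrow> x \<in> component ?F \<one>\<^bsub>G\<^esub> \<and> \<pi> x = x" for x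
    by (auto simp: P_simps L_def)
  have f: "f \<in> left_module_hom B ?FB Q"
    unfolding f_def by (rule Q.linear_combination_hom[OF q])
  then have "f \<in> left_module_hom B (identity_part G P) Q"
    using left_module_homD[OF f] by (auto simp: left_module_hom_def Pe P_simps)
  moreover have "bij_betw f (carrier (identity_part G P)) (carrier Q)"
  proof (rule bij_betw_byWitness[where f' = s])
    show "\<forall>x\<in>carrier (identity_part G P). s (f x) = x"
    proof
      fix x assume "x \<in> carrier (identity_part G P)"
      then have x: "x \<in> component ?F \<one>\<^bsub>G\<^esub>" "\<pi> x = x" using Pe by auto
      show "s (f x) = x" using \<pi>_eq[OF x(1)] x(2) by (simp add: f_def)
    qed
    show "\<forall>x\<in>carrier Q. f (s x) = x" using dual_basisD(4)[OF db] by (simp add: f_def)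
    show "f ` carrier (identity_part G P) \<subseteq> carrier Q"
      using left_module_homD(1)[OF f] by (auto simp: Pe)
    show "s ` carrier Q \<subseteq> carrier (identity_part G P)"
      using sF \<pi>_s by (auto simp: Pe simp del: graded_free_module_simps)
  qed
  ultimately show ?thesis by blast
qed

section \<open>Transport of exact sequences along isomorphisms, and the conclusion\<close>

lemma left_module_hom_inv_into:
  assumes "left_module R M" "f \<in> left_module_hom R M N" "bij_betw f (carrier M) (carrier N)"
  shows "inv_into (carrier M) f \<in> left_module_hom R N M"
proof -
  interpret M: left_module R M by fact
  let ?g = "inv_into (carrier M) f"
  have g: "?g y \<in> carrier M" "f (?g y) = y" if "y \<in> carrier N" for y
    using that assms(3) by (auto simp: bij_betw_def inv_into_into f_inv_into_f)
  have eq: "?g y = x" if "x \<in> carrier M" "f x = y" for x y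
    using that assms(3) by (auto simp: bij_betw_def)
  show ?thesis
    unfolding left_module_hom_def
  proof (intro CollectI conjI ballI)
    show "?g (x \<oplus>\<^bsub>N\<^esub> y) = ?g x \<oplus>\<^bsub>M\<^esub> ?g y" if "x \<in> carrier N" "y \<in> carrier N" for x y
      by (rule eq) (simp_all add: g that left_module_homD(2)[OF assms(2)])
    show "?g (a \<odot>\<^bsub>N\<^esub> x) = a \<odot>\<^bsub>M\<^esub> ?g x" if "a \<in> carrier R" "x \<in> carrier N" for a x
      by (rule eq) (simp_all add: g that left_module_homD(3)[OF assms(2)])
  qed (use g in blast)
qed

text \<open>Both maps are conjugated by the given bijections. Only zero is sent to zero by the
  linear bijection \<open>c\<close>, so the kernel of the new second map corresponds under
  \<open>b\<close> to that of \<open>g\<close>.\<close>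

lemma short_exact_iso:
  assumes "left_module R P2" "left_module R Q2"
    and ex: "short_exact P1 P P2 f g" and f: "f \<in> left_module_hom R P1 P" and g: "g \<in> left_module_hom R P P2"
    and a: "bij_betw a (carrier P1) (carrier Q1)"
    and b: "bij_betw b (carrier P) (carrier Q)"
    and c: "c \<in> left_module_hom R P2 Q2" "bij_betw c (carrier P2) (carrier Q2)"
  shows "short_exact Q1 Q Q2 (\<lambda>x. b (f (inv_into (carrier P1) a x))) (\<lambda>x. c (g (inv_into (carrier P) b x)))"
proof -
  let ?a = "inv_into (carrier P1) a" and ?b = "inv_into (carrier P) b"
  interpret P2: left_module R P2 by fact
  interpret Q2: left_module R Q2 by fact
  interpret c: abelian_group_hom P2 Q2 c by (rule left_module_hom_additive[OF assms(1,2) c(1)])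
  have a': "bij_betw ?a (carrier Q1) (carrier P1)" and b': "bij_betw ?b (carrier Q) (carrier P)"
    using a b by (auto intro: bij_betw_inv_into)
  have im_a: "?a ` carrier Q1 = carrier P1" and im_b: "?b ` carrier Q = carrier P"
    using a' b' by (auto simp: bij_betw_def)
  have bb: "?b (b x) = x" if "x \<in> carrier P" for x
    using that b by (auto simp: bij_betw_def)
  have bb': "b (?b y) = y" "?b y \<in> carrier P" if "y \<in> carrier Q" for y
    using that b b' by (auto simp: bij_betw_def f_inv_into_f)
  have c0: "c z = \<zero>\<^bsub>Q2\<^esub> \<longleftrightarrow> z = \<zero>\<^bsub>P2\<^esub>" if "z \<in> carrier P2" for z
    using inj_onD[of c "carrier P2" z "\<zero>\<^bsub>P2\<^esub>"] c(2) that c.hom_zero by (auto simp: bij_betw_def)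
  have f_inj: "inj_on f (carrier P1)" and im_f: "f ` carrier P1 = {x \<in> carrier P. g x = \<zero>\<^bsub>P2\<^esub>}"
    and im_g: "g ` carrier P = carrier P2"
    using ex by (auto simp: short_exact_def)
  have fP: "f x \<in> carrier P" if "x \<in> carrier P1" for x using left_module_homD(1)[OF f that] .
  show ?thesis
    unfolding short_exact_def
  proof (intro conjI)
    have "inj_on (b \<circ> (f \<circ> ?a)) (carrier Q1)"
    proof (intro comp_inj_on)
      show "inj_on ?a (carrier Q1)" using a' by (simp add: bij_betw_def)
      show "inj_on f (?a ` carrier Q1)" using f_inj im_a by simp
      have "(f \<circ> ?a) ` carrier Q1 \<subseteq> carrier P" unfolding image_comp[symmetric] im_a using fP by blast
      then show "inj_on b ((f \<circ> ?a) ` carrier Q1)" using b inj_on_subset by (auto simp: bij_betw_def)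
    qed
    then show "inj_on (\<lambda>x. b (f (?a x))) (carrier Q1)" by (simp add: comp_def)
    have "(\<lambda>x. b (f (?a x))) ` carrier Q1 = b ` f ` ?a ` carrier Q1" by (simp add: image_image)
    also have "\<dots> = b ` {x \<in> carrier P. g x = \<zero>\<^bsub>P2\<^esub>}" by (simp only: im_a im_f)
    also have "\<dots> = {y \<in> carrier Q. g (?b y) = \<zero>\<^bsub>P2\<^esub>}"
    proof safe
      fix y assume y: "y \<in> carrier Q" "g (?b y) = \<zero>\<^bsub>P2\<^esub>"
      then show "y \<in> b ` {x \<in> carrier P. g x = \<zero>\<^bsub>P2\<^esub>}"
        using bb' by (intro image_eqI[where x = "?b y"]) auto
    qed (use b bb in \<open>auto simp: bij_betw_def\<close>)
    also have "\<dots> = {y \<in> carrier Q. c (g (?b y)) = \<zero>\<^bsub>Q2\<^esub>}"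
      using c0 left_module_homD(1)[OF g] bb' by auto
    finally show "(\<lambda>x. b (f (?a x))) ` carrier Q1 = {x \<in> carrier Q. c (g (?b x)) = \<zero>\<^bsub>Q2\<^esub>}" .
    have "(\<lambda>x. c (g (?b x))) ` carrier Q = c ` g ` ?b ` carrier Q" by (simp add: image_image)
    also have "\<dots> = carrier Q2" using c(2) by (simp add: im_b im_g bij_betw_def)
    finally show "(\<lambda>x. c (g (?b x))) ` carrier Q = carrier Q2" .
  qed
qed

theorem proposition5p2p5:
  fixes G :: "('g, 'x) monoid_scheme"
    and R :: "('r, 'y) ring_scheme"
    and A :: "'g \<Rightarrow> 'r set"
  assumes "graded_ring G R A"
    and "strongly_graded G R A"
  shows "K0_gr G R A \<cong> K0 (identity_component G R A)"
proof -
  interpret strongly_graded_ring G R A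
    using assms by (simp add: strongly_graded_ring_def strongly_graded_ring_axioms_def graded_ring_def
        strongly_graded_def direct_sum_def direct_sum_axioms_def ring.is_abelian_group)
  have gr: "strongly_graded_module G R A P" if "P \<in> graded_fg_projectives G R A" for P
    using that strongly_graded_moduleI[of P] by (simp add: graded_fg_projectives_def)
  have lm: "left_module B P" if "P \<in> fg_projectives B" for P
    using that by (simp add: fg_projectives_def)
  show ?thesis
    unfolding K0_gr_def K0_def
  \<comment> \<open>The goals left to the final \<open>fact\<close> are that
    \<open>identity_part G\<close> maps objects to objects and that it reaches every object up to
    isomorphism.\<close>
  proof (rule Grothendieck_group_iso[where \<Phi> = "identity_part G"])
    fix P :: "('r, nat \<Rightarrow> 'r) module"
    have "(\<lambda>x. x) \<in> left_module_hom B P P" by (auto simp: left_module_hom_def)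
    then show "\<exists>f\<in>left_module_hom B P P. bij_betw f (carrier P) (carrier P)"
      by (rule bexI[rotated]) (simp add: bij_betw_def)
  next
    fix P Q :: "('r, nat \<Rightarrow> 'r) module"
    assume "P \<in> fg_projectives B" "\<exists>f\<in>left_module_hom B P Q. bij_betw f (carrier P) (carrier Q)"
    then show "\<exists>f\<in>left_module_hom B Q P. bij_betw f (carrier Q) (carrier P)"
      using left_module_hom_inv_into lm bij_betw_inv_into by blast
  next
    fix P Q T :: "('r, nat \<Rightarrow> 'r) module"
    assume "\<exists>f\<in>left_module_hom B P Q. bij_betw f (carrier P) (carrier Q)"
      "\<exists>f\<in>left_module_hom B Q T. bij_betw f (carrier Q) (carrier T)"
    then obtain f g where f: "f \<in> left_module_hom B P Q" "bij_betw f (carrier P) (carrier Q)"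
      and g: "g \<in> left_module_hom B Q T" "bij_betw g (carrier Q) (carrier T)" by blast
    show "\<exists>f\<in>left_module_hom B P T. bij_betw f (carrier P) (carrier T)"
      using bij_betw_trans[OF f(2) g(2)]
      by (intro bexI[OF _ left_module_hom_comp[OF f(1) g(1)]]) (simp add: comp_def)
  next
    fix P1 P P2 Q1 Q Q2 :: "('r, nat \<Rightarrow> 'r) module"
    assume Ob: "P1 \<in> fg_projectives B" "P \<in> fg_projectives B" "P2 \<in> fg_projectives B" "Q2 \<in> fg_projectives B"
    assume "\<exists>f\<in>left_module_hom B P1 Q1. bij_betw f (carrier P1) (carrier Q1)"
      "\<exists>f\<in>left_module_hom B P Q. bij_betw f (carrier P) (carrier Q)"
      "\<exists>f\<in>left_module_hom B P2 Q2. bij_betw f (carrier P2) (carrier Q2)"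
      "\<exists>f\<in>left_module_hom B P1 P. \<exists>g\<in>left_module_hom B P P2. short_exact P1 P P2 f g"
    then obtain a b c f g where a: "a \<in> left_module_hom B P1 Q1" "bij_betw a (carrier P1) (carrier Q1)"
      and b: "b \<in> left_module_hom B P Q" "bij_betw b (carrier P) (carrier Q)"
      and c: "c \<in> left_module_hom B P2 Q2" "bij_betw c (carrier P2) (carrier Q2)"
      and f: "f \<in> left_module_hom B P1 P" and g: "g \<in> left_module_hom B P P2"
      and ex: "short_exact P1 P P2 f g" by blast
    note a' = left_module_hom_inv_into[OF lm[OF Ob(1)] a] and b' = left_module_hom_inv_into[OF lm[OF Ob(2)] b]
    show "\<exists>f\<in>left_module_hom B Q1 Q. \<exists>g\<in>left_module_hom B Q Q2. short_exact Q1 Q Q2 f g"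
      by (rule bexI[OF _ left_module_hom_comp[OF a' left_module_hom_comp[OF f b(1)]]],
          rule bexI[OF _ left_module_hom_comp[OF b' left_module_hom_comp[OF g c(1)]]],
          rule short_exact_iso[OF lm[OF Ob(3)] lm[OF Ob(4)] ex f g a(2) b(2) c])
  next
    fix P Q :: "('g, 'r, nat \<Rightarrow> 'r) graded_module"
    assume "P \<in> graded_fg_projectives G R A" "Q \<in> graded_fg_projectives G R A"
    then show "(\<exists>f\<in>graded_hom G R P Q. bij_betw f (carrier P) (carrier Q)) \<longleftrightarrow>
      (\<exists>f\<in>left_module_hom B (identity_part G P) (identity_part G Q).
        bij_betw f (carrier (identity_part G P)) (carrier (identity_part G Q)))"
      by (intro ex_iso_iff_identity_part gr)
  next
    fix P1 P P2 :: "('g, 'r, nat \<Rightarrow> 'r) graded_module"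
    assume "P1 \<in> graded_fg_projectives G R A" "P \<in> graded_fg_projectives G R A"
      "P2 \<in> graded_fg_projectives G R A"
    then show "(\<exists>f\<in>graded_hom G R P1 P. \<exists>g\<in>graded_hom G R P P2. short_exact P1 P P2 f g) \<longleftrightarrow>
      (\<exists>f\<in>left_module_hom B (identity_part G P1) (identity_part G P).
        \<exists>g\<in>left_module_hom B (identity_part G P) (identity_part G P2).
          short_exact (identity_part G P1) (identity_part G P) (identity_part G P2) f g)"
      by (intro ex_short_exact_iff_identity_part gr)
  qed (fact identity_part_fg_projective graded_projective_of_fg_projective)+
qed

end
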